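(* Let $p\ge 2$ be an integer, let $\Bbbk$ be a field of characteristic zero containing a primitive $2p$-th root of unity $q$, let $\overline{U}_q(sl_2)$ be the restricted quantum group over $\Bbbk$ with integral $\Lambda=F^{p-1}E^{p-1}\sum_{j=0}^{2p-1}K^{j}$, and let $V$ be the $p$-dimensional simple $\overline{U}_q(sl_2)$-module with basis $v_0,\dots,v_{p-1}$ and action $Kv_n=q^{p-1-2n}v_n$, $Ev_n=[n][p-n]v_{n-1}$, $Fv_n=v_{n+1}$ (with $v_p=v_{-1}=0$). Then $$\chi_V(\Lambda^{\{2\}}) = 4p^3 ([p-1]!)^4.$$
   Context: $[n]=\frac{q^n-q^{-n}}{q-q^{-1}}$, $[n]!=[1][2]\cdots[n]$, $[0]!=1$. $\overline{U}_q(sl_2)$ is the Hopf algebra generated by $E,F,K$ with relations $E^p=F^p=0$, $K^{2p}=1$, $KEK^{-1}=q^2E$, $KFK^{-1}=q^{-2}F$, $[E,F]=EF-FE=\frac{K-K^{-1}}{q-q^{-1}}$; comultiplication $\Delta(E)=1\otimes E+E\otimes K$, $\Delta(F)=K^{-1}\otimes F+F\otimes 1$, $\Delta(K)=K\otimes K$; counit $\varepsilon(E)=\varepsilon(F)=0$, $\varepsilon(K)=1$; antipode $S(E)=-EK^{-1}$, $S(F)=-KF$, $S(K)=K^{-1}$. It has dimension $2p^3$ and is unimodular; $\Lambda$ is a two-sided integral. For a finite-dimensional unimodular Hopf algebra $H$ (Sweedler notation $\Delta(a)=a_1\otimes a_2$), let $\lambda$ be a nonzero right integral of $H^*$ ($\lambda(a_1)a_2=\lambda(a)1$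 for all $a$) and let the distinguished group-like element $g$ be determined by $a_1\lambda(a_2)=\lambda(a)g$. The commutator is $\{a,b\}:=a_1S^2(b_1)S(a_2)S^{-1}(b_2)g^{-1}$, and $\Lambda^{\{2\}}:=\{\Lambda,\Lambda\}$. $\chi_V$ is the character of $V$. *)

theory Defs
  imports Complex_Main "HOL-Library.Multiset" "HOL-Library.Poly_Mapping"
begin

locale k_algebra = vector_space scale
  for scale :: "'k::field \<Rightarrow> 'h::ring_1 \<Rightarrow> 'h" +
  assumes scale_mult_left: "scale c x * y = scale c (x * y)"
    and scale_mult_right: "x * scale c y = scale c (x * y)"

datatype 'x word = Word (letters: "'x list")

instantiation word :: (type) monoid_add
begin

definition zero_word :: "'a word" where "0 = Word []"

definition plus_word :: "'a word \<Rightarrow> 'a word \<Rightarrow> 'a word"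
  where "u + v = Word (letters u @ letters v)"

instance by standard (simp_all add: zero_word_def plus_word_def)

end

text \<open>The addition of words is concatenation, so the type below, with the convolution product
  of finitely supported functions, is the free associative algebra over \<open>'k\<close> on \<open>'x\<close>.\<close>

type_synonym ('x, 'k) free_algebra = "'x word \<Rightarrow>\<^sub>0 'k"

definition free_gen :: "'x \<Rightarrow> ('x, 'k::field) free_algebra"
  where "free_gen x = Poly_Mapping.single (Word [x]) 1"

definition free_const :: "'k::field \<Rightarrow> ('x, 'k) free_algebra"
  where "free_const c = Poly_Mapping.single 0 c"

definition free_eval ::
  "('k::field \<Rightarrow> 'h::ring_1 \<Rightarrow> 'h) \<Rightarrow> ('x \<Rightarrow> 'h) \<Rightarrow> ('x, 'k) free_algebra \<Rightarrow> 'h"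
  where "free_eval scale \<gamma> f =
    (\<Sum>w\<in>Poly_Mapping.keys f. scale (Poly_Mapping.lookup f w) (prod_list (map \<gamma> (letters w))))"

inductive_set two_sided_ideal :: "'r::ring_1 set \<Rightarrow> 'r set" for R where
  zero: "0 \<in> two_sided_ideal R"
| gen: "r \<in> R \<Longrightarrow> a * r * b \<in> two_sided_ideal R"
| add: "x \<in> two_sided_ideal R \<Longrightarrow> y \<in> two_sided_ideal R \<Longrightarrow> x + y \<in> two_sided_ideal R"

definition presented_by ::
  "('k::field \<Rightarrow> 'h::ring_1 \<Rightarrow> 'h) \<Rightarrow> ('x \<Rightarrow> 'h) \<Rightarrow> ('x, 'k) free_algebra set \<Rightarrow> bool"
  where "presented_by scale \<gamma> R \<longleftrightarrow>
    surj (free_eval scale \<gamma>) \<and> {f. free_eval scale \<gamma> f = 0} = two_sided_ideal R"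

text \<open>A list \<open>[x\<^sub>1, \<dots>, x\<^sub>n]\<close> stands for the pure tensor \<open>x\<^sub>1 \<otimes> \<dots> \<otimes> x\<^sub>n\<close> in the \<open>n\<close>-fold tensor power
  of \<open>'h\<close> over \<open>'k\<close>, and a finite multiset of lists for the sum of its members. Two such formal
  sums represent the same tensor iff they are related by the smallest additive congruence that makes
  the pure tensors multilinear. (Negatives are scalar multiples by \<open>-1\<close>.)\<close>

inductive tensor_eq ::
  "('k::field \<Rightarrow> 'h::ring_1 \<Rightarrow> 'h) \<Rightarrow> 'h list multiset \<Rightarrow> 'h list multiset \<Rightarrow> bool"
  for scale where
  zero: "tensor_eq scale {#xs @ 0 # ys#} {#}"
| add: "tensor_eq scale {#xs @ (a + b) # ys#} {#xs @ a # ys, xs @ b # ys#}"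
| scale: "tensor_eq scale {#xs @ scale c a # ys @ b # zs#} {#xs @ a # ys @ scale c b # zs#}"
| refl: "tensor_eq scale X X"
| sym: "tensor_eq scale X Y \<Longrightarrow> tensor_eq scale Y X"
| trans: "tensor_eq scale X Y \<Longrightarrow> tensor_eq scale Y Z \<Longrightarrow> tensor_eq scale X Z"
| plus: "tensor_eq scale X X' \<Longrightarrow> tensor_eq scale Y Y' \<Longrightarrow> tensor_eq scale (X + Y) (X' + Y')"

definition tensor2_eq ::
  "('k::field \<Rightarrow> 'h::ring_1 \<Rightarrow> 'h) \<Rightarrow> ('h \<times> 'h) multiset \<Rightarrow> ('h \<times> 'h) multiset \<Rightarrow> bool"
  where "tensor2_eq scale X Y \<longleftrightarrow>
    tensor_eq scale (image_mset (\<lambda>(x, y). [x, y]) X) (image_mset (\<lambda>(x, y). [x, y]) Y)"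

text \<open>\<open>\<Delta> x\<close> is a formal sum of pairs representing the coproduct of \<open>x\<close>. Only its class modulo
  \<open>tensor2_eq\<close> is meaningful: all axioms are imposed modulo this relation, and Sweedler sums
  \<open>\<Sum>(x1, x2)\<in>#\<Delta> x. f x1 x2\<close> are only formed for bilinear \<open>f\<close>, where they depend on nothing else.\<close>

locale hopf_algebra = k_algebra scale
  for scale :: "'k::field \<Rightarrow> 'h::ring_1 \<Rightarrow> 'h" +
  fixes \<Delta> :: "'h \<Rightarrow> ('h \<times> 'h) multiset"
    and \<epsilon> :: "'h \<Rightarrow> 'k"
    and S :: "'h \<Rightarrow> 'h"
  assumes comult_add: "tensor2_eq scale (\<Delta> (x + y)) (\<Delta> x + \<Delta> y)"
    and comult_scale:
      "tensor2_eq scale (\<Delta> (scale c x)) (image_mset (\<lambda>(x1, x2). (scale c x1, x2)) (\<Delta> x))"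
    and comult_one: "tensor2_eq scale (\<Delta> 1) {#(1, 1)#}"
    and comult_mult:
      "tensor2_eq scale (\<Delta> (x * y))
        (\<Sum>(x1, x2)\<in>#\<Delta> x. image_mset (\<lambda>(y1, y2). (x1 * y1, x2 * y2)) (\<Delta> y))"
    and coassoc:
      "tensor_eq scale
        (\<Sum>(x1, x2)\<in>#\<Delta> x. image_mset (\<lambda>(a, b). [a, b, x2]) (\<Delta> x1))
        (\<Sum>(x1, x2)\<in>#\<Delta> x. image_mset (\<lambda>(a, b). [x1, a, b]) (\<Delta> x2))"
    and counit_linear: "Vector_Spaces.linear scale (*) \<epsilon>"
    and counit_one: "\<epsilon> 1 = 1"
    and counit_mult: "\<epsilon> (x * y) = \<epsilon> x * \<epsilon> y"
    and counit_left: "(\<Sum>(x1, x2)\<in>#\<Delta> x. scale (\<epsilon> x1) x2) = x"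
    and counit_right: "(\<Sum>(x1, x2)\<in>#\<Delta> x. scale (\<epsilon> x2) x1) = x"
    and antipode_linear: "Vector_Spaces.linear scale scale S"
    and antipode_left: "(\<Sum>(x1, x2)\<in>#\<Delta> x. S x1 * x2) = scale (\<epsilon> x) 1"
    and antipode_right: "(\<Sum>(x1, x2)\<in>#\<Delta> x. x1 * S x2) = scale (\<epsilon> x) 1"

definition right_integral_dual ::
  "('k::field \<Rightarrow> 'h::ring_1 \<Rightarrow> 'h) \<Rightarrow> ('h \<Rightarrow> ('h \<times> 'h) multiset) \<Rightarrow> ('h \<Rightarrow> 'k) \<Rightarrow> bool"
  where "right_integral_dual scale \<Delta> lam \<longleftrightarrow>
    Vector_Spaces.linear scale (*) lam \<and>
    (\<forall>a. (\<Sum>(a1, a2)\<in>#\<Delta> a. scale (lam a1) a2) = scale (lam a) 1)"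

definition grouplike ::
  "('k::field \<Rightarrow> 'h::ring_1 \<Rightarrow> 'h) \<Rightarrow> ('h \<Rightarrow> ('h \<times> 'h) multiset) \<Rightarrow> 'h \<Rightarrow> bool"
  where "grouplike scale \<Delta> g \<longleftrightarrow> g \<noteq> 0 \<and> tensor2_eq scale (\<Delta> g) {#(g, g)#}"

definition distinguished_grouplike ::
  "('k::field \<Rightarrow> 'h::ring_1 \<Rightarrow> 'h) \<Rightarrow> ('h \<Rightarrow> ('h \<times> 'h) multiset) \<Rightarrow> ('h \<Rightarrow> 'k) \<Rightarrow> 'h \<Rightarrow> bool"
  where "distinguished_grouplike scale \<Delta> lam g \<longleftrightarrow>
    grouplike scale \<Delta> g \<and>
    (\<forall>a. (\<Sum>(a1, a2)\<in>#\<Delta> a. scale (lam a2) a1) = scale (lam a) g)"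

definition mult_inverse :: "'h::ring_1 \<Rightarrow> 'h"
  where "mult_inverse x = (THE y. x * y = 1 \<and> y * x = 1)"

definition commutator ::
  "('h::ring_1 \<Rightarrow> ('h \<times> 'h) multiset) \<Rightarrow> ('h \<Rightarrow> 'h) \<Rightarrow> 'h \<Rightarrow> 'h \<Rightarrow> 'h \<Rightarrow> 'h"
  where "commutator \<Delta> S g a b =
    (\<Sum>(a1, a2)\<in>#\<Delta> a. \<Sum>(b1, b2)\<in>#\<Delta> b.
      a1 * S (S b1) * S a2 * inv S b2 * mult_inverse g)"

locale algebra_module = k_algebra scale + V: vector_space scaleV
  for scale :: "'k::field \<Rightarrow> 'h::ring_1 \<Rightarrow> 'h"
    and scaleV :: "'k \<Rightarrow> 'v::ab_group_add \<Rightarrow> 'v" +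
  fixes act :: "'h \<Rightarrow> 'v \<Rightarrow> 'v"
  assumes act_linear: "Vector_Spaces.linear scaleV scaleV (act x)"
    and act_add: "act (x + y) v = act x v + act y v"
    and act_scale: "act (scale c x) v = scaleV c (act x v)"
    and act_one: "act 1 v = v"
    and act_mult: "act (x * y) v = act x (act y v)"

text \<open>The character is the trace of the action, computed in a finite basis \<open>B\<close>.\<close>

definition character ::
  "('k::field \<Rightarrow> 'v::ab_group_add \<Rightarrow> 'v) \<Rightarrow> 'v set \<Rightarrow> ('h \<Rightarrow> 'v \<Rightarrow> 'v) \<Rightarrow> 'h \<Rightarrow> 'k"
  where "character scaleV B act x = (\<Sum>b\<in>B. module.representation scaleV B (act x b) b)"

definition primitive_root_of_unity :: "nat \<Rightarrow> 'k::field \<Rightarrow> bool"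
  where "primitive_root_of_unity n q \<longleftrightarrow>
    n > 0 \<and> q ^ n = 1 \<and> (\<forall>m. 0 < m \<and> m < n \<longrightarrow> q ^ m \<noteq> 1)"

definition q_int :: "'k::field \<Rightarrow> nat \<Rightarrow> 'k"
  where "q_int q n = (q ^ n - inverse q ^ n) / (q - inverse q)"

definition q_fact :: "'k::field \<Rightarrow> nat \<Rightarrow> 'k"
  where "q_fact q n = (\<Prod>i = 1..n. q_int q i)"

datatype uq_generator = Gen_E | Gen_F | Gen_K

text \<open>Since \<open>K\<^sup>2\<^sup>p = 1\<close>, the inverse of \<open>K\<close> is written \<open>K\<^sup>2\<^sup>p\<^sup>-\<^sup>1\<close>. Each relation \<open>l = r\<close> is
  recorded as \<open>l - r\<close>.\<close>

definition uq_relations :: "nat \<Rightarrow> 'k::field \<Rightarrow> (uq_generator, 'k) free_algebra set"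
  where "uq_relations p q =
    (let e = free_gen Gen_E; f = free_gen Gen_F; k = free_gen Gen_K; k' = k ^ (2 * p - 1)
     in {e ^ p, f ^ p, k ^ (2 * p) - 1,
         k * e * k' - free_const (q ^ 2) * e,
         k * f * k' - free_const (inverse q ^ 2) * f,
         e * f - f * e - free_const (inverse (q - inverse q)) * (k - k')})"

locale restricted_quantum_sl2 = hopf_algebra scale \<Delta> \<epsilon> S
  for scale :: "'k::field \<Rightarrow> 'h::ring_1 \<Rightarrow> 'h"
    and \<Delta> :: "'h \<Rightarrow> ('h \<times> 'h) multiset"
    and \<epsilon> :: "'h \<Rightarrow> 'k"
    and S :: "'h \<Rightarrow> 'h" +
  fixes p :: nat and q :: 'k and E F K :: 'h
  assumes presentation:
      "presented_by scale (case_uq_generator E F K) (uq_relations p q)"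
    and comult_E: "tensor2_eq scale (\<Delta> E) {#(1, E), (E, K)#}"
    and comult_F: "tensor2_eq scale (\<Delta> F) {#(K ^ (2 * p - 1), F), (F, 1)#}"
    and comult_K: "tensor2_eq scale (\<Delta> K) {#(K, K)#}"
    and counit_E: "\<epsilon> E = 0"
    and counit_F: "\<epsilon> F = 0"
    and counit_K: "\<epsilon> K = 1"
    and antipode_E: "S E = - (E * K ^ (2 * p - 1))"
    and antipode_F: "S F = - (K * F)"
    and antipode_K: "S K = K ^ (2 * p - 1)"

end

theory Submission
  imports Defs
begin

text \<open>The proof computes the trace on the Steinberg module \<open>V\<close> from Schur-type orthogonality for the
  integral \<open>\<Lambda>\<close>. Write \<open>w\<^sub>i = q ^ (p - 1 - 2 i)\<close> for the eigenvalue of \<open>K\<close> on \<open>v\<^sub>i\<close>.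

  For an endomorphism \<open>Z\<close> of \<open>V\<close> put \<open>a \<cdot> Z = a\<^sub>1 Z S(a\<^sub>2)\<close>. As \<open>S\<close> reverses products, this is an action
  of the quantum group. The identities \<open>K \<Lambda> = \<Lambda>\<close> and \<open>F \<Lambda> = 0\<close> force \<open>\<Lambda> \<cdot> Z\<close> to be a scalar \<open>t Z\<close>
  (lemma \<open>adj_Lam_scalar\<close>), and \<open>\<Lambda> K = \<Lambda>\<close> and \<open>\<Lambda> E = 0\<close> force the linear form \<open>t\<close> to be
  \<open>t Z = c tr (K Z)\<close> for a constant \<open>c\<close> (lemma \<open>trace_form_eq\<close>). Following one matrix unit through
  \<open>\<Lambda> = F^(p-1) E^(p-1) (\<Sum>j. K^j)\<close> gives \<open>c\<^sup>2 = 4 p\<^sup>2 ([p-1]!)^4\<close> (lemma \<open>trace_const_square\<close>). Reading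
  \<open>\<Lambda> \<cdot> Z = t Z\<close> in coordinates yields the orthogonality of the diagonal coefficients of \<open>\<Lambda>\<^sub>1\<close> and
  \<open>S(\<Lambda>\<^sub>2)\<close>: the sum of \<open>(\<Lambda>\<^sub>1)\<^sub>i\<^sub>i S(\<Lambda>\<^sub>2)\<^sub>n\<^sub>n\<close> is \<open>c w\<^sub>n\<close> if \<open>i = n\<close>, and zero otherwise
  (lemma \<open>matrix_orthogonality\<close>).

  The square of the antipode is conjugation by \<open>K\<close>, so the commutator of \<open>\<Lambda>\<close> with itself contains
  exactly the expression \<open>\<Lambda>\<^sub>1 Z S(\<Lambda>\<^sub>2)\<close>. Replacing it by the form \<open>t\<close> and applying orthogonality to
  the second copy of \<open>\<Lambda>\<close>, the \<open>n\<close>-th diagonal entry becomes \<open>c w\<^sub>n \<cdot> c w\<^sub>n\<close> times the eigenvalue of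
  \<open>g\<^sup>-\<^sup>1\<close> on \<open>v\<^sub>n\<close>. It remains to see that \<open>g\<close> acts on \<open>V\<close> as \<open>K\<^sup>2\<close>; then each of the \<open>p\<close> diagonal
  entries equals \<open>c\<^sup>2\<close>, and the trace is \<open>p c\<^sup>2 = 4 p\<^sup>3 ([p-1]!)^4\<close>.

  The action of \<open>g\<close> is obtained from the integral \<open>\<lambda>\<close> of the dual alone (lemma \<open>mat_g\<close>). Letting \<open>V\<close> act
  on one leg of the coproduct gives matrices over the quantum group, \<open>R a\<close> with entries
  \<open>(a\<^sub>2)\<^sub>i\<^sub>j a\<^sub>1\<close> and \<open>L a\<close> with entries \<open>(a\<^sub>1)\<^sub>i\<^sub>j a\<^sub>2\<close>, both multiplicative in \<open>a\<close>, such that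
  \<open>\<lambda> (R a) = \<lambda> a \<cdot> 1\<close> and \<open>\<lambda> (L a) = \<lambda> a \<cdot> g\<close>. Off-diagonal entries of \<open>R\<close> show that \<open>\<lambda>\<close> vanishes on
  every ordered monomial \<open>F^i E^m K^n\<close> except those with \<open>i = m = p - 1\<close>. As these monomials span, \<open>\<lambda>\<close> is
  nonzero on one of the latter, and comparing the leading terms of \<open>R\<close> and \<open>L\<close> at that monomial
  determines \<open>g\<close> on \<open>V\<close>.\<close>

section \<open>Sweedler sums\<close>

text \<open>These are the maps on pairs that factor through \<open>H \<otimes> H\<close>. Only additivity and the
  exchange of a scalar are asked for, so that the target may be any abelian group: a matrix entry, an
  element of \<open>H\<close> or a vector of a module.\<close>

definition balanced ::
  "('k::field \<Rightarrow> 'h::ring_1 \<Rightarrow> 'h) \<Rightarrow> ('h \<Rightarrow> 'h \<Rightarrow> 'w::ab_group_add) \<Rightarrow> bool"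
  where "balanced scale f \<longleftrightarrow>
    (\<forall>a b y. f (a + b) y = f a y + f b y) \<and> (\<forall>x a b. f x (a + b) = f x a + f x b) \<and>
    (\<forall>c x y. f (scale c x) y = f x (scale c y))"

lemma additive_zero:
  fixes f :: "'a::ab_group_add \<Rightarrow> 'b::ab_group_add"
  assumes "\<And>a b. f (a + b) = f a + f b"
  shows "f 0 = 0"
  using assms[of 0 0] by simp

lemma additive_sum_mset:
  fixes f :: "'a::ab_group_add \<Rightarrow> 'b::ab_group_add"
  assumes "\<And>a b. f (a + b) = f a + f b"
  shows "f (\<Sum>x\<in>#M. g x) = (\<Sum>x\<in>#M. f (g x))"
  by (induction M) (simp_all add: assms additive_zero[of f])

lemma sum_mset_sum_mset:
  fixes f :: "'a \<Rightarrow> 'b::comm_monoid_add"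
  shows "(\<Sum>y\<in>#(\<Sum>x\<in>#M. h x). f y) = (\<Sum>x\<in>#M. \<Sum>y\<in>#h x. f y)"
  by (induction M) simp_all

lemma sum_sum_mset_swap:
  fixes f :: "'a \<Rightarrow> 'b \<Rightarrow> 'c::comm_monoid_add"
  shows "(\<Sum>k\<in>A. \<Sum>x\<in>#M. f k x) = (\<Sum>x\<in>#M. \<Sum>k\<in>A. f k x)"
  by (induction M) (simp_all add: sum.distrib)

lemma sum_mset_product:
  fixes f :: "'a \<Rightarrow> 'r::semiring_0"
  shows "(\<Sum>x\<in>#M. f x) * (\<Sum>y\<in>#N. g y) = (\<Sum>x\<in>#M. \<Sum>y\<in>#N. f x * g y)"
  by (induction M) (simp_all add: distrib_right sum_mset_distrib_left sum_mset.distrib)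

lemma sum_mset_cong_pair:
  assumes "\<And>x y. f x y = g x y"
  shows "(\<Sum>(x, y)\<in>#M. f x y) = (\<Sum>(x, y)\<in>#M. g x y)"
  using assms by simp

text \<open>The relation \<^const>\<open>tensor_eq\<close> is the least congruence making pure tensors multilinear,
  so a map on lists that respects its generating cases descends to tensors of every length; the
  bilinear and trilinear cases below come from maps that vanish on lists of any other length.\<close>

lemma tensor_eq_sum_mset:
  fixes F :: "'h::ring_1 list \<Rightarrow> 'w::ab_group_add"
  assumes add: "\<And>xs a b ys. F (xs @ (a + b) # ys) = F (xs @ a # ys) + F (xs @ b # ys)"
    and bal: "\<And>xs c a ys b zs. F (xs @ scale c a # ys @ b # zs) = F (xs @ a # ys @ scale c b # zs)"
    and eq: "tensor_eq scale X Y"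
  shows "(\<Sum>xs\<in>#X. F xs) = (\<Sum>xs\<in>#Y. F xs)"
  using eq
proof (induction rule: tensor_eq.induct)
  case (zero xs ys)
  have "F (xs @ 0 # ys) = 0"
    using additive_zero[of "\<lambda>a. F (xs @ a # ys)"] add by blast
  then show ?case by simp
qed (simp_all add: add bal)

lemma tensor2_eq_sum_mset:
  fixes f :: "'h::ring_1 \<Rightarrow> 'h \<Rightarrow> 'w::ab_group_add"
  assumes f: "balanced scale f" and eq: "tensor2_eq scale X Y"
  shows "(\<Sum>(x, y)\<in>#X. f x y) = (\<Sum>(x, y)\<in>#Y. f x y)"
proof -
  define F where "F = (\<lambda>xs. case xs of [x, y] \<Rightarrow> f x y | _ \<Rightarrow> 0)"
  have f_add: "f (a + b) y = f a y + f b y" "f x (a + b) = f x a + f x b"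
    and f_bal: "f (scale c x) y = f x (scale c y)" for a b c x y
    using f by (simp_all add: balanced_def)
  have add: "F (xs @ (a + b) # ys) = F (xs @ a # ys) + F (xs @ b # ys)" for xs a b ys
    by (auto simp: F_def f_add append_eq_Cons_conv Cons_eq_append_conv split: list.split)
  have bal: "F (xs @ scale c a # ys @ b # zs) = F (xs @ a # ys @ scale c b # zs)"
    for xs c a ys b zs
    by (auto simp: F_def f_bal append_eq_Cons_conv Cons_eq_append_conv split: list.split)
  have "(\<Sum>(x, y)\<in>#Z. f x y) = (\<Sum>xs\<in>#image_mset (\<lambda>(x, y). [x, y]) Z. F xs)" for Z
    by (simp add: F_def image_mset.compositionality o_def case_prod_unfold)
  then show ?thesis
    using tensor_eq_sum_mset[of F scale, OF add bal] eq by (simp add: tensor2_eq_def)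
qed

context hopf_algebra
begin

lemma sweedler_add:
  assumes "balanced scale f"
  shows "(\<Sum>(z1, z2)\<in>#\<Delta> (x + y). f z1 z2) = (\<Sum>(z1, z2)\<in>#\<Delta> x. f z1 z2) + (\<Sum>(z1, z2)\<in>#\<Delta> y. f z1 z2)"
  using tensor2_eq_sum_mset[OF assms comult_add[of x y]] by simp

lemma sweedler_zero:
  assumes "balanced scale f"
  shows "(\<Sum>(z1, z2)\<in>#\<Delta> 0. f z1 z2) = 0"
  using sweedler_add[OF assms, of 0 0] by simp

lemma sweedler_one:
  assumes "balanced scale f"
  shows "(\<Sum>(z1, z2)\<in>#\<Delta> 1. f z1 z2) = f 1 1"
  using tensor2_eq_sum_mset[OF assms comult_one] by simp

lemma sweedler_mult:
  assumes "balanced scale f"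
  shows "(\<Sum>(z1, z2)\<in>#\<Delta> (x * y). f z1 z2) =
    (\<Sum>(x1, x2)\<in>#\<Delta> x. \<Sum>(y1, y2)\<in>#\<Delta> y. f (x1 * y1) (x2 * y2))"
  using tensor2_eq_sum_mset[OF assms comult_mult[of x y]]
  by (simp add: sum_mset_sum_mset image_mset.compositionality o_def case_prod_unfold)

lemma sweedler_coassoc:
  fixes f :: "'h \<Rightarrow> 'h \<Rightarrow> 'h \<Rightarrow> 'w::ab_group_add"
  assumes f12: "\<And>z. balanced scale (\<lambda>x y. f x y z)" and f23: "\<And>x. balanced scale (f x)"
  shows "(\<Sum>(x', x3)\<in>#\<Delta> x. \<Sum>(x1, x2)\<in>#\<Delta> x'. f x1 x2 x3) =
    (\<Sum>(x1, x')\<in>#\<Delta> x. \<Sum>(x2, x3)\<in>#\<Delta> x'. f x1 x2 x3)"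
proof -
  define F where "F = (\<lambda>xs. case xs of [x, y, z] \<Rightarrow> f x y z | _ \<Rightarrow> 0)"
  have f_add: "f (a + b) y z = f a y z + f b y z" "f y (a + b) z = f y a z + f y b z"
      "f y z (a + b) = f y z a + f y z b"
    and f_bal: "f (scale c a) b z = f a (scale c b) z" "f z (scale c a) b = f z a (scale c b)"
    for a b c y z
    using f12 f23 by (simp_all add: balanced_def)
  have add: "F (xs @ (a + b) # ys) = F (xs @ a # ys) + F (xs @ b # ys)" for xs a b ys
    by (auto simp: F_def f_add append_eq_Cons_conv Cons_eq_append_conv split: list.split)
  have bal: "F (xs @ scale c a # ys @ b # zs) = F (xs @ a # ys @ scale c b # zs)"
    for xs c a ys b zs
    by (auto simp: F_def f_bal append_eq_Cons_conv Cons_eq_append_conv split: list.split)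
  show ?thesis
    using tensor_eq_sum_mset[of F scale, OF add bal coassoc[of x]]
    by (simp add: sum_mset_sum_mset image_mset.compositionality o_def case_prod_unfold F_def)
qed

section \<open>The antipode and group-like elements\<close>

lemma S_add: "S (x + y) = S x + S y"
  and S_scale: "S (scale c x) = scale c (S x)"
  using antipode_linear by (simp_all add: Vector_Spaces.linear_iff)

lemma counit_add: "\<epsilon> (x + y) = \<epsilon> x + \<epsilon> y"
  and counit_scale: "\<epsilon> (scale c x) = c * \<epsilon> x"
  using counit_linear by (simp_all add: Vector_Spaces.linear_iff)

lemma S_one: "S 1 = 1"
proof -
  have "balanced scale (\<lambda>x y. S x * y)"
    by (simp add: balanced_def S_add S_scale distrib_left distrib_right scale_mult_left scale_mult_right)
  from sweedler_one[OF this] show ?thesis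
    by (simp add: antipode_left counit_one)
qed

text \<open>Both sides are values of one sum,
  \<open>S (x\<^sub>1 y\<^sub>1) x\<^sub>2 y\<^sub>2 S y\<^sub>3 S x\<^sub>3\<close>. Contracting the first two legs
  of \<open>x\<close> and \<open>y\<close> by the left antipode law leaves \<open>S y S x\<close>; contracting the last two by
  the right antipode law leaves \<open>S (x y)\<close>; coassociativity identifies the two bracketings.\<close>

lemma S_mult: "S (x * y) = S y * S x"
proof -
  note lin = S_add S_scale distrib_left distrib_right scale_mult_left scale_mult_right
  define P where "P = (\<lambda>x1 x2 x3 y1 y2 y3. S (x1 * y1) * (x2 * y2) * (S y3 * S x3))"
  have L: "(\<Sum>(u, x3)\<in>#\<Delta> x. \<Sum>(x1, x2)\<in>#\<Delta> u. \<Sum>(w, y3)\<in>#\<Delta> y. \<Sum>(y1, y2)\<in>#\<Delta> w. P x1 x2 x3 y1 y2 y3)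
      = S y * S x"
  proof -
    have bal: "balanced scale (\<lambda>x y. S x * y)"
      by (simp add: balanced_def lin)
    have "(\<Sum>(x1, x2)\<in>#\<Delta> u. \<Sum>(w, y3)\<in>#\<Delta> y. \<Sum>(y1, y2)\<in>#\<Delta> w. P x1 x2 x3 y1 y2 y3)
      = scale (\<epsilon> u) (S y * S x3)" for u x3
    proof -
      have "(\<Sum>(x1, x2)\<in>#\<Delta> u. \<Sum>(w, y3)\<in>#\<Delta> y. \<Sum>(y1, y2)\<in>#\<Delta> w. P x1 x2 x3 y1 y2 y3)
        = (\<Sum>(w, y3)\<in>#\<Delta> y. \<Sum>(x1, x2)\<in>#\<Delta> u. \<Sum>(y1, y2)\<in>#\<Delta> w. P x1 x2 x3 y1 y2 y3)"
        unfolding case_prod_unfold by (rule sum_mset.swap)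
      \<comment> \<open>Here the left antipode law is applied to the product of the legs \<open>u\<close> and \<open>w\<close>.\<close>
      also have "\<dots> = (\<Sum>(w, y3)\<in>#\<Delta> y. scale (\<epsilon> (u * w)) (S y3 * S x3))"
      proof (rule sum_mset_cong_pair)
        fix w y3
        have "(\<Sum>(x1, x2)\<in>#\<Delta> u. \<Sum>(y1, y2)\<in>#\<Delta> w. P x1 x2 x3 y1 y2 y3)
          = (\<Sum>(x1, x2)\<in>#\<Delta> u. \<Sum>(y1, y2)\<in>#\<Delta> w. S (x1 * y1) * (x2 * y2)) * (S y3 * S x3)"
          by (simp add: P_def sum_mset_distrib_right case_prod_unfold)
        also have "\<dots> = scale (\<epsilon> (u * w)) (S y3 * S x3)"
          unfolding sweedler_mult[OF bal, of u w, symmetric] by (simp add: antipode_left scale_mult_left)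
        finally show "(\<Sum>(x1, x2)\<in>#\<Delta> u. \<Sum>(y1, y2)\<in>#\<Delta> w. P x1 x2 x3 y1 y2 y3)
          = scale (\<epsilon> (u * w)) (S y3 * S x3)" .
      qed
      also have "\<dots> = scale (\<epsilon> u) (S (\<Sum>(w, y3)\<in>#\<Delta> y. scale (\<epsilon> w) y3) * S x3)"
        by (simp add: additive_sum_mset[of "\<lambda>z. scale (\<epsilon> u) (S z * S x3)"] S_add distrib_right
            scale_right_distrib case_prod_unfold counit_mult S_scale scale_mult_left)
      finally show ?thesis by (simp add: counit_left)
    qed
    then have "(\<Sum>(u, x3)\<in>#\<Delta> x. \<Sum>(x1, x2)\<in>#\<Delta> u. \<Sum>(w, y3)\<in>#\<Delta> y. \<Sum>(y1, y2)\<in>#\<Delta> w. P x1 x2 x3 y1 y2 y3)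
      = (\<Sum>(u, x3)\<in>#\<Delta> x. scale (\<epsilon> u) (S y * S x3))"
      by simp
    also have "\<dots> = S y * S (\<Sum>(u, x3)\<in>#\<Delta> x. scale (\<epsilon> u) x3)"
      by (simp add: additive_sum_mset[of "\<lambda>z. S y * S z"] lin case_prod_unfold)
    finally show ?thesis by (simp add: counit_left)
  qed
  have R: "(\<Sum>(x1, u)\<in>#\<Delta> x. \<Sum>(x2, x3)\<in>#\<Delta> u. \<Sum>(y1, w)\<in>#\<Delta> y. \<Sum>(y2, y3)\<in>#\<Delta> w. P x1 x2 x3 y1 y2 y3)
      = S (x * y)"
  proof -
    have inner: "(\<Sum>(y1, w)\<in>#\<Delta> y. \<Sum>(y2, y3)\<in>#\<Delta> w. P x1 x2 x3 y1 y2 y3)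
      = S (x1 * y) * (x2 * S x3)" for x1 x2 x3
    proof -
      have "(\<Sum>(y1, w)\<in>#\<Delta> y. \<Sum>(y2, y3)\<in>#\<Delta> w. P x1 x2 x3 y1 y2 y3)
        = (\<Sum>(y1, w)\<in>#\<Delta> y. S (x1 * y1) * x2 * (\<Sum>(y2, y3)\<in>#\<Delta> w. y2 * S y3) * S x3)"
        by (simp add: P_def sum_mset_distrib_right sum_mset_distrib_left case_prod_unfold mult.assoc)
      also have "\<dots> = S (x1 * (\<Sum>(y1, w)\<in>#\<Delta> y. scale (\<epsilon> w) y1)) * (x2 * S x3)"
        by (simp add: additive_sum_mset[of "\<lambda>z. S (x1 * z) * (x2 * S x3)"] lin case_prod_unfold
            antipode_right[unfolded case_prod_unfold] mult.assoc)
      finally show ?thesis by (simp add: counit_right)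
    qed
    have "(\<Sum>(x1, u)\<in>#\<Delta> x. \<Sum>(x2, x3)\<in>#\<Delta> u. S (x1 * y) * (x2 * S x3))
      = (\<Sum>(x1, u)\<in>#\<Delta> x. S (x1 * y) * (\<Sum>(x2, x3)\<in>#\<Delta> u. x2 * S x3))"
      by (simp add: sum_mset_distrib_left case_prod_unfold)
    also have "\<dots> = S ((\<Sum>(x1, u)\<in>#\<Delta> x. scale (\<epsilon> u) x1) * y)"
      by (simp add: additive_sum_mset[of "\<lambda>z. S (z * y)"] lin case_prod_unfold
            antipode_right[unfolded case_prod_unfold])
    finally show ?thesis by (simp add: inner counit_right)
  qed
  have y: "(\<Sum>(w, y3)\<in>#\<Delta> y. \<Sum>(y1, y2)\<in>#\<Delta> w. P x1 x2 x3 y1 y2 y3) =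
     (\<Sum>(y1, w)\<in>#\<Delta> y. \<Sum>(y2, y3)\<in>#\<Delta> w. P x1 x2 x3 y1 y2 y3)" for x1 x2 x3
    by (rule sweedler_coassoc) (simp_all add: balanced_def P_def lin)
  have x: "(\<Sum>(u, x3)\<in>#\<Delta> x. \<Sum>(x1, x2)\<in>#\<Delta> u. \<Sum>(y1, w)\<in>#\<Delta> y. \<Sum>(y2, y3)\<in>#\<Delta> w. P x1 x2 x3 y1 y2 y3) =
     (\<Sum>(x1, u)\<in>#\<Delta> x. \<Sum>(x2, x3)\<in>#\<Delta> u. \<Sum>(y1, w)\<in>#\<Delta> y. \<Sum>(y2, y3)\<in>#\<Delta> w. P x1 x2 x3 y1 y2 y3)"
    by (rule sweedler_coassoc)
      (simp_all add: balanced_def P_def lin sum_mset.distrib case_prod_unfold)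
  show ?thesis
    using L R by (simp add: y x)
qed

text \<open>The counit law gives \<open>\<epsilon> g = 1\<close> because \<open>g \<noteq> 0\<close>, and then the two antipode laws say that
  \<open>S g\<close> is a two-sided inverse.\<close>

lemma grouplike_inverse:
  assumes "grouplike scale \<Delta> g"
  shows "g * S g = 1" "S g * g = 1" "mult_inverse g = S g"
proof -
  have g: "g \<noteq> 0" "tensor2_eq scale (\<Delta> g) {#(g, g)#}"
    using assms by (simp_all add: grouplike_def)
  note lin = S_add S_scale distrib_left distrib_right scale_mult_left scale_mult_right
  have "balanced scale (\<lambda>x y. scale (\<epsilon> x) y)"
    by (simp add: balanced_def counit_add counit_scale scale_left_distrib scale_right_distrib mult.commute)
  from tensor2_eq_sum_mset[OF this g(2)] have "scale (\<epsilon> g) g = scale 1 g"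
    by (simp add: counit_left)
  then have eps: "\<epsilon> g = 1"
    using g(1) by (metis scale_cancel_right)
  have "balanced scale (\<lambda>x y. x * S y)" "balanced scale (\<lambda>x y. S x * y)"
    by (simp_all add: balanced_def lin)
  from this[THEN tensor2_eq_sum_mset, OF g(2)] show 1: "g * S g = 1" and 2: "S g * g = 1"
    by (simp_all add: antipode_left antipode_right eps)
  show "mult_inverse g = S g"
    unfolding mult_inverse_def
  proof (rule the_equality)
    show "y = S g" if "g * y = 1 \<and> y * g = 1" for y
      by (metis 1 that mult.assoc mult_1_left mult_1_right)
  qed (simp add: 1 2)
qed

end

section \<open>Algebras with a presentation\<close>

lemma poly_mapping_single_induct [case_names zero add]:
  fixes f :: "'a \<Rightarrow>\<^sub>0 'b::comm_monoid_add"
  assumes "P 0" and "\<And>a b f. P f \<Longrightarrow> P (Poly_Mapping.single a b + f)"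
  shows "P f"
proof (induction f rule: update_induct)
  case (update f a b)
  have "Poly_Mapping.update a b f = Poly_Mapping.single a b + f"
    using update(1)
    by (intro poly_mapping_eqI) (auto simp: lookup_update lookup_add lookup_single in_keys_iff)
  then show ?case using assms(2) update by simp
qed (rule assms(1))

context k_algebra
begin

lemma free_eval_superset:
  assumes "finite W" "Poly_Mapping.keys f \<subseteq> W"
  shows "free_eval scale \<gamma> f =
    (\<Sum>w\<in>W. scale (Poly_Mapping.lookup f w) (prod_list (map \<gamma> (letters w))))"
  unfolding free_eval_def
  by (rule sum.mono_neutral_left) (use assms in \<open>auto simp: in_keys_iff\<close>)

lemma free_eval_add: "free_eval scale \<gamma> (f + g) = free_eval scale \<gamma> f + free_eval scale \<gamma> g"
proof -
  let ?W = "Poly_Mapping.keys f \<union> Poly_Mapping.keys g"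
  have fin: "finite ?W" by simp
  show ?thesis
    by (simp add: free_eval_superset[OF fin] Poly_Mapping.keys_add lookup_add
        scale_left_distrib sum.distrib)
qed

lemma free_eval_single:
  "free_eval scale \<gamma> (Poly_Mapping.single w c) = scale c (prod_list (map \<gamma> (letters w)))"
  by (simp add: free_eval_def)

lemma free_eval_zero: "free_eval scale \<gamma> 0 = 0"
  by (simp add: free_eval_def)

lemma free_eval_one: "free_eval scale \<gamma> 1 = 1"
  using free_eval_single[of \<gamma> 0 1] by (simp only: single_one) (simp add: zero_word_def)

lemma free_eval_mult: "free_eval scale \<gamma> (f * g) = free_eval scale \<gamma> f * free_eval scale \<gamma> g"
proof (induction f rule: poly_mapping_single_induct)
  case (add a b f)
  have "free_eval scale \<gamma> (Poly_Mapping.single a b * g) =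
      free_eval scale \<gamma> (Poly_Mapping.single a b) * free_eval scale \<gamma> g"
  proof (induction g rule: poly_mapping_single_induct)
    case (add a' b' g)
    then show ?case
      by (simp add: distrib_left free_eval_add mult_single free_eval_single plus_word_def
          scale_mult_left scale_mult_right)
  qed (simp add: free_eval_zero)
  with add show ?case by (simp add: distrib_right free_eval_add)
qed (simp add: free_eval_zero)

lemma free_eval_power: "free_eval scale \<gamma> (f ^ n) = free_eval scale \<gamma> f ^ n"
  by (induction n) (simp_all add: free_eval_one free_eval_mult)

lemma free_eval_diff: "free_eval scale \<gamma> (f - g) = free_eval scale \<gamma> f - free_eval scale \<gamma> g"
  using free_eval_add[of \<gamma> "f - g" g] by simp

lemma free_eval_gen: "free_eval scale \<gamma> (free_gen x) = \<gamma> x"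
  by (simp add: free_gen_def free_eval_single)

lemma free_eval_const: "free_eval scale \<gamma> (free_const c) = scale c 1"
  by (simp add: free_const_def free_eval_single zero_word_def)

lemma presented_by_relation:
  assumes "presented_by scale \<gamma> R" "r \<in> R"
  shows "free_eval scale \<gamma> r = 0"
proof -
  have "1 * r * 1 \<in> two_sided_ideal R"
    by (rule two_sided_ideal.gen) (rule assms)
  then show ?thesis using assms(1) by (auto simp: presented_by_def)
qed

text \<open>Surjectivity of the evaluation is used in this form: an algebra is the linear span of the
  words in its generators, hence the only left-stable subspace through \<open>1\<close>.\<close>

lemma presented_by_span:
  assumes pres: "presented_by scale \<gamma> R"
    and W: "subspace W" "1 \<in> W" "\<And>x w. w \<in> W \<Longrightarrow> \<gamma> x * w \<in> W"
  shows "h \<in> W"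
proof -
  obtain f where h: "h = free_eval scale \<gamma> f"
    using pres unfolding presented_by_def by (metis surjD)
  have "prod_list (map \<gamma> xs) \<in> W" for xs
    by (induction xs) (simp_all add: W)
  then show ?thesis
    unfolding h free_eval_def by (intro subspace_sum subspace_scale W(1))
qed

end

section \<open>The restricted quantum group and its ordered monomials\<close>

context restricted_quantum_sl2
begin

definition Kinv where "Kinv = K ^ (2 * p - 1)"

lemma relations:
  shows E_power: "E ^ p = 0" and F_power: "F ^ p = 0" and K_power: "K ^ (2 * p) = 1"
    and KEK: "K * E * Kinv = scale (q ^ 2) E"
    and KFK: "K * F * Kinv = scale (inverse q ^ 2) F"
    and EF: "E * F - F * E = scale (inverse (q - inverse q)) (K - Kinv)"
proof -
  let ?R = "uq_relations p q"
  have *: "free_eval scale (case_uq_generator E F K) r = 0" if "r \<in> ?R" for r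
    using presented_by_relation[OF presentation that] .
  note simps = free_eval_add free_eval_diff free_eval_mult free_eval_power free_eval_one
    free_eval_gen free_eval_const uq_relations_def Let_def scale_mult_left Kinv_def
  show "E ^ p = 0"
    using *[of "free_gen Gen_E ^ p"] by (simp add: simps)
  show "F ^ p = 0"
    using *[of "free_gen Gen_F ^ p"] by (simp add: simps)
  show "K ^ (2 * p) = 1"
    using *[of "free_gen Gen_K ^ (2 * p) - 1"] by (simp add: simps)
  show "K * E * Kinv = scale (q ^ 2) E"
    using *[of "free_gen Gen_K * free_gen Gen_E * free_gen Gen_K ^ (2 * p - 1)
      - free_const (q ^ 2) * free_gen Gen_E"] by (simp add: simps)
  show "K * F * Kinv = scale (inverse q ^ 2) F"
    using *[of "free_gen Gen_K * free_gen Gen_F * free_gen Gen_K ^ (2 * p - 1)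
      - free_const (inverse q ^ 2) * free_gen Gen_F"] by (simp add: simps)
  show "E * F - F * E = scale (inverse (q - inverse q)) (K - Kinv)"
    using *[of "free_gen Gen_E * free_gen Gen_F - free_gen Gen_F * free_gen Gen_E
      - free_const (inverse (q - inverse q)) * (free_gen Gen_K - free_gen Gen_K ^ (2 * p - 1))"]
    by (simp add: simps)
qed

lemma generated_induct:
  assumes "subspace W" "1 \<in> W" "\<And>w. w \<in> W \<Longrightarrow> E * w \<in> W"
    "\<And>w. w \<in> W \<Longrightarrow> F * w \<in> W" "\<And>w. w \<in> W \<Longrightarrow> K * w \<in> W"
  shows "h \<in> W"
  by (rule presented_by_span[OF presentation]) (use assms in \<open>auto split: uq_generator.split\<close>)

end

locale restricted_quantum_sl2_at_root = restricted_quantum_sl2 scale \<Delta> \<epsilon> S p q E F K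
  for scale :: "'k::field \<Rightarrow> 'h::ring_1 \<Rightarrow> 'h"
    and \<Delta> :: "'h \<Rightarrow> ('h \<times> 'h) multiset" and \<epsilon> :: "'h \<Rightarrow> 'k" and S :: "'h \<Rightarrow> 'h"
    and p :: nat and q :: 'k and E F K :: 'h +
  assumes p_ge_2: "p \<ge> 2" and q_root: "primitive_root_of_unity (2 * p) q"
begin

lemma q_nonzero: "q \<noteq> 0"
  using q_root p_ge_2 by (auto simp: primitive_root_of_unity_def power_0_left)

lemma K_Kinv: "K * Kinv = 1" and Kinv_K: "Kinv * K = 1"
proof -
  have "2 * p = Suc (2 * p - 1)" using p_ge_2 by simp
  then show "K * Kinv = 1" "Kinv * K = 1"
    unfolding Kinv_def using K_power by (metis power_Suc, metis power_Suc2)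
qed

lemma K_cancel: "K * (Kinv * x) = x" "Kinv * (K * x) = x" "x * K * Kinv = x" "x * Kinv * K = x"
  using K_Kinv Kinv_K by (simp_all add: mult.assoc) (simp_all add: mult.assoc[symmetric])

lemma K_E: "K * E = scale (q ^ 2) (E * K)"
proof -
  have "K * E = K * E * Kinv * K" by (simp add: K_cancel)
  then show ?thesis by (simp add: KEK scale_mult_left)
qed

lemma K_F: "K * F = scale (inverse q ^ 2) (F * K)"
proof -
  have "K * F = K * F * Kinv * K" by (simp add: K_cancel)
  then show ?thesis by (simp add: KFK scale_mult_left)
qed

lemma K_power_E: "K ^ n * E = scale ((q ^ 2) ^ n) (E * K ^ n)"
proof (induction n)
  case (Suc n)
  have "K ^ Suc n * E = K * (K ^ n * E)" by (simp add: mult.assoc)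
  also have "\<dots> = scale ((q ^ 2) ^ n) (K * E * K ^ n)" by (simp add: Suc scale_mult_right mult.assoc)
  also have "\<dots> = scale ((q ^ 2) ^ Suc n) (E * K ^ Suc n)"
    by (simp add: K_E scale_mult_left mult.assoc mult.commute)
  finally show ?case .
qed simp

lemma K_E_power: "K * E ^ n = scale ((q ^ 2) ^ n) (E ^ n * K)"
proof (induction n)
  case (Suc n)
  have "K * E ^ Suc n = K * E * E ^ n" by (simp add: mult.assoc)
  also have "\<dots> = scale (q ^ 2) (E * (K * E ^ n))" by (simp add: K_E scale_mult_left mult.assoc)
  also have "\<dots> = scale ((q ^ 2) ^ Suc n) (E ^ Suc n * K)"
    by (simp add: Suc scale_mult_right mult.assoc)
  finally show ?case .
qed simp

lemma K_F_power: "K * F ^ n = scale ((inverse q ^ 2) ^ n) (F ^ n * K)"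
proof (induction n)
  case (Suc n)
  have "K * F ^ Suc n = K * F * F ^ n" by (simp add: mult.assoc)
  also have "\<dots> = scale (inverse q ^ 2) (F * (K * F ^ n))" by (simp add: K_F scale_mult_left mult.assoc)
  also have "\<dots> = scale ((inverse q ^ 2) ^ Suc n) (F ^ Suc n * K)"
    by (simp add: Suc scale_mult_right mult.assoc)
  finally show ?case .
qed simp

text \<open>Conjugation by \<open>K\<close> scales \<open>x\<close>, so conjugation by the inverse scales it back.\<close>

lemma Kinv_conj: "K * x = scale c (x * K) \<Longrightarrow> c \<noteq> 0 \<Longrightarrow> Kinv * x = scale (inverse c) (x * Kinv)"
proof -
  assume x: "K * x = scale c (x * K)" and c: "c \<noteq> 0"
  have "x * Kinv = Kinv * (K * x) * Kinv" by (simp add: K_cancel)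
  also have "\<dots> = scale c (Kinv * x)"
    unfolding x by (simp add: scale_mult_left scale_mult_right mult.assoc K_cancel K_Kinv)
  finally show ?thesis using c by simp
qed

lemma Kinv_F: "Kinv * F = scale (q ^ 2) (F * Kinv)"
  using Kinv_conj[OF K_F] by (simp add: q_nonzero power_inverse)

lemma Kinv_E_power: "Kinv * E ^ m = scale (inverse ((q ^ 2) ^ m)) (E ^ m * Kinv)"
  using Kinv_conj[OF K_E_power] by (simp add: q_nonzero)

lemma E_F: "E * F = F * E + scale (inverse (q - inverse q)) (K - Kinv)"
  using EF by (simp add: algebra_simps)

definition pbw :: "nat \<Rightarrow> nat \<Rightarrow> nat \<Rightarrow> 'h" where
  "pbw i m n = F ^ i * E ^ m * K ^ n"

lemma F_pbw: "F * pbw i m n = pbw (Suc i) m n"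
  by (simp add: pbw_def mult.assoc)

lemma K_pbw: "K * pbw i m n = scale ((inverse q ^ 2) ^ i * (q ^ 2) ^ m) (pbw i m (Suc n))"
proof -
  have "K * pbw i m n = scale ((inverse q ^ 2) ^ i) (F ^ i * (K * E ^ m) * K ^ n)"
    unfolding pbw_def by (simp add: mult.assoc[symmetric] K_F_power scale_mult_left)
  then show ?thesis
    unfolding K_E_power by (simp add: pbw_def mult.assoc scale_mult_left scale_mult_right)
qed

text \<open>The span of the ordered monomials contains \<open>1\<close>, so it suffices that it is stable under left
  multiplication by the generators. For \<open>E\<close> this is an induction on the exponent of \<open>F\<close>: moving \<open>E\<close>
  past one \<open>F\<close> costs a polynomial in \<open>K\<close>, which the span already absorbs.\<close>

lemma pbw_span: "h \<in> span (range (\<lambda>(i, m, n). pbw i m n))"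
proof -
  let ?W = "span (range (\<lambda>(i, m, n). pbw i m n))"
  have base: "pbw i m n \<in> ?W" for i m n
    by (rule span_base) (rule range_eqI[of _ _ "(i, m, n)"], simp)
  have stable: "x * w \<in> ?W" if w: "w \<in> ?W" and x: "\<And>i m n. x * pbw i m n \<in> ?W" for x w
    using w
  proof (induction rule: span_induct_alt)
    case (step c y z)
    then show ?case
      using x by (auto simp: distrib_left scale_mult_right intro!: span_add span_scale)
  qed (simp add: span_zero)
  have F: "F * w \<in> ?W" if "w \<in> ?W" for w
  proof (rule stable[OF that])
    show "F * pbw i m n \<in> ?W" for i m n
      by (simp only: F_pbw base)
  qed
  have K: "K * w \<in> ?W" if "w \<in> ?W" for w
  proof (rule stable[OF that])
    show "K * pbw i m n \<in> ?W" for i m n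
      by (simp only: K_pbw span_scale base)
  qed
  have Kn: "K ^ n * w \<in> ?W" if "w \<in> ?W" for w n
    using that by (induction n) (simp_all add: K mult.assoc)
  have "E * (F ^ i * (E ^ m * K ^ n)) \<in> ?W" for i m n
  proof (induction i)
    case 0
    have "E * (E ^ m * K ^ n) = pbw 0 (Suc m) n" by (simp add: pbw_def mult.assoc)
    then show ?case by (simp only: base power_0 mult_1_left)
  next
    case (Suc i)
    let ?x = "F ^ i * (E ^ m * K ^ n)"
    have x: "?x \<in> ?W" using base[of i m n] by (simp add: pbw_def mult.assoc)
    have "E * (F ^ Suc i * (E ^ m * K ^ n)) = E * F * ?x" by (simp add: mult.assoc)
    also have "\<dots> = F * (E * ?x) + scale (inverse (q - inverse q)) (K * ?x - Kinv * ?x)"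
      unfolding E_F by (simp add: distrib_right left_diff_distrib scale_mult_left mult.assoc)
    also have "\<dots> \<in> ?W"
      by (intro span_add span_scale span_diff F K Kn[of _ "2 * p - 1", folded Kinv_def] Suc x)
    finally show ?case .
  qed
  then have E: "E * w \<in> ?W" if "w \<in> ?W" for w
    using stable[OF that, of E] by (simp add: pbw_def mult.assoc)
  have "1 \<in> ?W" using base[of 0 0 0] by (simp only: pbw_def power_0 mult_1_left)
  then show ?thesis
    using generated_induct[of ?W h] E F K by blast
qed

lemmas antipode_Kinv = antipode_K[folded Kinv_def] and antipode_Einv = antipode_E[folded Kinv_def]

lemma S_Kinv: "S Kinv = K"
proof -
  have "Kinv * S Kinv = 1"
    using arg_cong[OF Kinv_K, of S] by (simp add: S_mult S_one antipode_Kinv)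
  then have "K * (Kinv * S Kinv) = K" by simp
  then show ?thesis by (simp add: K_cancel)
qed

lemma S_neg: "S (- x) = - S x"
  using S_scale[of "-1" x] by simp

text \<open>Since \<open>S\<close> reverses products, \<open>S \<circ> S\<close> is an algebra endomorphism; so is conjugation by
  \<open>K\<close>, and the two agree on the generators. In particular \<open>S\<close> is bijective, with the inverse
  computed next.\<close>

lemma S_S: "S (S x) = K * x * Kinv"
proof -
  have "x \<in> {x. S (S x) = K * x * Kinv}"
  proof (rule generated_induct)
    have gen: "S (S (y * x)) = K * (y * x) * Kinv"
      if "S (S y) = K * y * Kinv" "S (S x) = K * x * Kinv" for x y
      using that by (simp add: S_mult mult.assoc K_cancel)
    have "S (S E) = K * E * Kinv"
      by (simp only: antipode_Einv S_neg S_mult S_Kinv) (simp add: mult.assoc)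
    moreover have "S (S F) = K * F * Kinv"
      by (simp only: antipode_F S_neg S_mult antipode_Kinv) (simp add: mult.assoc)
    moreover have "S (S K) = K * K * Kinv"
      by (simp add: antipode_Kinv S_Kinv K_cancel)
    ultimately show "w \<in> {x. S (S x) = K * x * Kinv} \<Longrightarrow> E * w \<in> {x. S (S x) = K * x * Kinv}"
      "w \<in> {x. S (S x) = K * x * Kinv} \<Longrightarrow> F * w \<in> {x. S (S x) = K * x * Kinv}"
      "w \<in> {x. S (S x) = K * x * Kinv} \<Longrightarrow> K * w \<in> {x. S (S x) = K * x * Kinv}" for w
      using gen by auto
    show "subspace {x. S (S x) = K * x * Kinv}"
      by (rule subspaceI) (simp_all add: additive_zero[of S] S_add S_scale distrib_left distrib_right
          scale_mult_left scale_mult_right)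
  qed (simp add: S_one K_Kinv)
  then show ?thesis by simp
qed

lemma inv_S: "inv S x = Kinv * S x * K"
proof (rule inv_f_eq)
  show "inj S"
  proof (rule injI)
    fix x y assume "S x = S y"
    then have "K * x * Kinv = K * y * Kinv" by (metis S_S)
    then have "Kinv * (K * x * Kinv) * K = Kinv * (K * y * Kinv) * K" by simp
    then show "x = y" by (simp add: mult.assoc K_cancel Kinv_K)
  qed
  have "S (Kinv * S x * K) = Kinv * (K * x * Kinv) * K"
    by (simp only: S_mult antipode_Kinv S_Kinv S_S mult.assoc)
  then show "S (Kinv * S x * K) = x"
    by (simp add: mult.assoc K_cancel Kinv_K)
qed

end

section \<open>Leading terms of matrices of coproducts\<close>

context restricted_quantum_sl2_at_root
begin

lemma pbw_E: "pbw i m n * E = scale ((q ^ 2) ^ n) (pbw i (Suc m) n)"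
  by (simp add: pbw_def mult.assoc K_power_E scale_mult_right power_Suc2 del: power_Suc)

lemma pbw_K: "pbw i m n * K = pbw i m (Suc n)"
  by (simp add: pbw_def mult.assoc power_Suc2 del: power_Suc)

text \<open>The span of the ordered monomials whose exponents of \<open>F\<close> and \<open>E\<close> do not dominate
  \<open>(l, m)\<close>. At \<open>l = m = p - 1\<close> it contains all nonzero monomials except the top ones, and there
  the integral of the dual will vanish. The exponent of \<open>K\<close> is unrestricted, so that powers of
  \<open>K\<close> preserve these spans.\<close>

definition lower :: "nat \<Rightarrow> nat \<Rightarrow> 'h set" where
  "lower l m = span {pbw l' m' n |l' m' n. l' < l \<or> m' < m}"

lemma pbw_lower: "l' < l \<or> m' < m \<Longrightarrow> pbw l' m' n \<in> lower l m"
  unfolding lower_def by (rule span_base) blast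

lemma lower_add: "x \<in> lower l m \<Longrightarrow> y \<in> lower l m \<Longrightarrow> x + y \<in> lower l m"
  and lower_scale: "x \<in> lower l m \<Longrightarrow> scale c x \<in> lower l m"
  and lower_zero: "0 \<in> lower l m"
  by (simp_all add: lower_def span_add span_scale span_zero)

text \<open>Stability of these spans under a linear map need only be checked on monomials.\<close>

lemma lower_image:
  assumes x: "x \<in> lower l m"
    and f: "\<And>x y. f (x + y) = f x + f y" "\<And>c x. f (scale c x) = scale c (f x)"
    and gen: "\<And>l1 m1 n. l1 < l \<or> m1 < m \<Longrightarrow> f (pbw l1 m1 n) \<in> lower l' m'"
  shows "f x \<in> lower l' m'"
  using x[unfolded lower_def]
proof (induction rule: span_induct_alt)
  case base
  show ?case using additive_zero[of f] f(1) by (simp add: lower_zero)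
next
  case (step c y z)
  then show ?case by (auto simp: f intro!: lower_add lower_scale gen)
qed

lemma lower_mono: "x \<in> lower l m \<Longrightarrow> l \<le> l' \<Longrightarrow> m \<le> m' \<Longrightarrow> x \<in> lower l' m'"
  by (erule lower_image[where f = "\<lambda>x. x"]) (auto intro: pbw_lower)

lemma F_lower: "x \<in> lower l m \<Longrightarrow> F * x \<in> lower (Suc l) m"
  by (erule lower_image) (auto simp: distrib_left scale_mult_right F_pbw intro: pbw_lower)

lemma lower_E: "x \<in> lower l m \<Longrightarrow> x * E \<in> lower l (Suc m)"
  by (erule lower_image[where f = "\<lambda>x. x * E"])
    (auto simp: distrib_right scale_mult_left pbw_E intro: pbw_lower lower_scale)

lemma lower_K: "x \<in> lower l m \<Longrightarrow> x * K ^ s \<in> lower l m"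
proof (induction s)
  case (Suc s)
  have "x * K \<in> lower l m" if "x \<in> lower l m" for x
    using that by (rule lower_image[where f = "\<lambda>x. x * K"])
      (auto simp: distrib_right scale_mult_left pbw_K intro: pbw_lower)
  from this[OF Suc.IH[OF Suc.prems]] show ?case
    by (simp only: power_Suc2 mult.assoc)
qed simp

lemma K_lower: "x \<in> lower l m \<Longrightarrow> K ^ s * x \<in> lower l m"
proof (induction s)
  case (Suc s)
  have "K * x \<in> lower l m" if "x \<in> lower l m" for x
    using that by (rule lower_image)
      (auto simp: distrib_left scale_mult_right K_pbw intro: pbw_lower lower_scale)
  then show ?case using Suc by (simp add: mult.assoc)
qed simp

end

text \<open>The generators \<open>F\<close> and \<open>E\<close> act by bidiagonal matrices; the next four sums are the rows and
  columns of a product with such a matrix.\<close>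

lemma sum_lower_row:
  fixes z :: "nat \<Rightarrow> 'r::ring_1"
  assumes "i < p"
  shows "(\<Sum>k<p. (if i = k then x k else if i = Suc k then y k else 0) * z k) =
    x i * z i + (if i = 0 then 0 else y (i - 1) * z (i - 1))"
proof -
  have "(if i = k then x k else if i = Suc k then y k else 0) * z k =
      (if k = i then x k * z k else 0) + (if k = i - 1 then if i = 0 then 0 else y k * z k else 0)" for k
    by auto
  then show ?thesis using assms by (auto simp: sum.distrib less_imp_diff_less)
qed

lemma sum_upper_row:
  fixes z :: "nat \<Rightarrow> 'r::ring_1"
  assumes "i < p"
  shows "(\<Sum>k<p. (if i = k then x k else if k = Suc i then y k else 0) * z k) =
    x i * z i + (if Suc i < p then y (Suc i) * z (Suc i) else 0)"
proof -
  have "(if i = k then x k else if k = Suc i then y k else 0) * z k =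
      (if k = i then x k * z k else 0) + (if k = Suc i then y k * z k else 0)" for k
    by auto
  then show ?thesis using assms by (auto simp: sum.distrib less_imp_diff_less)
qed

lemma sum_lower_column:
  fixes z :: "nat \<Rightarrow> 'r::ring_1"
  assumes "j < p"
  shows "(\<Sum>k<p. z k * (if k = j then x k else if k = Suc j then y k else 0)) =
    z j * x j + (if Suc j < p then z (Suc j) * y (Suc j) else 0)"
proof -
  have "z k * (if k = j then x k else if k = Suc j then y k else 0) =
      (if k = j then z k * x k else 0) + (if k = Suc j then z k * y k else 0)" for k
    by auto
  then show ?thesis using assms by (auto simp: sum.distrib less_imp_diff_less)
qed

lemma sum_upper_column:
  fixes z :: "nat \<Rightarrow> 'r::ring_1"
  assumes "j < p"
  shows "(\<Sum>k<p. z k * (if k = j then x k else if j = Suc k then y k else 0)) =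
    z j * x j + (if j = 0 then 0 else z (j - 1) * y (j - 1))"
proof -
  have "z k * (if k = j then x k else if j = Suc k then y k else 0) =
      (if k = j then z k * x k else 0) + (if k = j - 1 then if j = 0 then 0 else z k * y k else 0)" for k
    by auto
  then show ?thesis using assms by (auto simp: sum.distrib less_imp_diff_less)
qed

text \<open>Applying the Steinberg module to one leg of the coproduct turns each element of \<open>H\<close> into a
  matrix over \<open>H\<close>. This can be done on either leg, and the two resulting families of matrices differ
  only in the diagonal weights \<open>\<alpha>\<close>, \<open>\<beta>\<close> of \<open>E\<close>, \<open>F\<close> and in the powers of \<open>K\<close> beside the
  diagonal. The locale records what both have in common.\<close>

locale coproduct_matrix = restricted_quantum_sl2_at_root scale \<Delta> \<epsilon> S p q E F K
  for scale :: "'k::field \<Rightarrow> 'h::ring_1 \<Rightarrow> 'h"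
    and \<Delta> :: "'h \<Rightarrow> ('h \<times> 'h) multiset" and \<epsilon> :: "'h \<Rightarrow> 'k" and S :: "'h \<Rightarrow> 'h"
    and p :: nat and q :: 'k and E F K :: 'h +
  fixes X :: "'h \<Rightarrow> nat \<Rightarrow> nat \<Rightarrow> 'h"
    and \<alpha> \<beta> \<kappa> c :: "nat \<Rightarrow> 'k" and r s :: nat
  assumes X_mult: "i < p \<Longrightarrow> j < p \<Longrightarrow> X (a * b) i j = (\<Sum>k<p. X a i k * X b k j)"
    and X_one: "i < p \<Longrightarrow> j < p \<Longrightarrow> X 1 i j = (if i = j then 1 else 0)"
    and X_K: "i < p \<Longrightarrow> j < p \<Longrightarrow> X K i j = (if i = j then scale (\<kappa> i) K else 0)"
    and X_F: "i < p \<Longrightarrow> j < p \<Longrightarrow>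
      X F i j = (if i = j then scale (\<beta> i) F else if i = Suc j then K ^ r else 0)"
    and X_E: "i < p \<Longrightarrow> j < p \<Longrightarrow>
      X E i j = (if i = j then scale (\<alpha> i) E else if j = Suc i then scale (c j) (K ^ s) else 0)"
begin

lemma X_F_left:
  assumes "i < p" "j < p"
  shows "X (F * x) i j = scale (\<beta> i) (F * X x i j) + (if i = 0 then 0 else K ^ r * X x (i - 1) j)"
proof -
  have "X (F * x) i j = (\<Sum>k<p. (if i = k then scale (\<beta> i) F else if i = Suc k then K ^ r else 0) * X x k j)"
    using assms by (simp add: X_mult X_F cong: if_cong)
  then show ?thesis using assms by (simp add: sum_lower_row scale_mult_left)
qed

lemma X_E_left:
  assumes "i < p" "j < p"
  shows "X (E * x) i j = scale (\<alpha> i) (E * X x i j) +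
    (if Suc i < p then scale (c (Suc i)) (K ^ s * X x (Suc i) j) else 0)"
proof -
  have "X (E * x) i j =
      (\<Sum>k<p. (if i = k then scale (\<alpha> i) E else if k = Suc i then scale (c k) (K ^ s) else 0) * X x k j)"
    using assms by (simp add: X_mult X_E cong: if_cong)
  then show ?thesis using assms by (simp add: sum_upper_row scale_mult_left)
qed

lemma X_F_right:
  assumes "i < p" "j < p"
  shows "X (x * F) i j = scale (\<beta> j) (X x i j * F) +
    (if Suc j < p then X x i (Suc j) * K ^ r else 0)"
proof -
  have "X (x * F) i j =
      (\<Sum>k<p. X x i k * (if k = j then scale (\<beta> k) F else if k = Suc j then K ^ r else 0))"
    using assms by (simp add: X_mult X_F cong: if_cong)
  then show ?thesis using assms by (simp add: sum_lower_column scale_mult_right)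
qed

lemma X_E_right:
  assumes "i < p" "j < p"
  shows "X (x * E) i j = scale (\<alpha> j) (X x i j * E) +
    (if j = 0 then 0 else scale (c j) (X x i (j - 1) * K ^ s))"
proof -
  have "X (x * E) i j =
      (\<Sum>k<p. X x i k * (if k = j then scale (\<alpha> k) E else if j = Suc k then scale (c j) (K ^ s) else 0))"
    using assms by (simp add: X_mult X_E cong: if_cong)
  then show ?thesis using assms by (simp add: sum_upper_column scale_mult_right)
qed

lemma X_K_right:
  assumes "i < p" "j < p"
  shows "X (x * K) i j = scale (\<kappa> j) (X x i j * K)"
proof -
  have "X (x * K) i j = (\<Sum>k<p. if k = j then X x i k * scale (\<kappa> k) K else 0)"
    using assms by (simp add: X_mult X_K if_distrib[of "\<lambda>y. _ * y"] cong: if_cong)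
  then show ?thesis using assms by (simp add: scale_mult_right)
qed

lemma X_K_power_right:
  assumes "i < p" "j < p"
  shows "X (x * K ^ n) i j = scale (\<kappa> j ^ n) (X x i j * K ^ n)"
proof (induction n)
  case (Suc n)
  have "X (x * K ^ Suc n) i j = X (x * K ^ n * K) i j"
    by (simp only: power_Suc2 mult.assoc)
  also have "\<dots> = scale (\<kappa> j) (X (x * K ^ n) i j * K)"
    using assms by (rule X_K_right)
  also have "\<dots> = scale (\<kappa> j ^ Suc n) (X x i j * (K ^ n * K))"
    by (simp add: Suc scale_mult_left mult.assoc)
  finally show ?case by (simp only: power_Suc2)
qed simp

text \<open>The part of the coproduct matrix of an ordered monomial that still contains the whole
  monomial: the contribution of the diagonal entries of all the factors.\<close>

definition lead :: "nat \<Rightarrow> nat \<Rightarrow> nat \<Rightarrow> nat \<Rightarrow> nat \<Rightarrow> 'h" where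
  "lead l m n i j = (if i = j then scale (\<beta> j ^ l * \<alpha> j ^ m * \<kappa> j ^ n) (pbw l m n) else 0)"

text \<open>Each off-diagonal step replaces a factor \<open>F\<close> by a power of \<open>K\<close>, so everything outside the
  leading part has lost a factor. The induction peels \<open>F\<close> off on the left; the analogous induction
  for \<open>E\<close> peels on the right, so that no \<open>E\<close> ever has to cross an \<open>F\<close>.\<close>

lemma leading_term_F:
  "i < p \<Longrightarrow> j < p \<Longrightarrow> X (pbw l 0 0) i j - lead l 0 0 i j \<in> lower l 0"
proof (induction l arbitrary: i)
  case 0
  then show ?case by (simp add: pbw_def lead_def X_one lower_zero)
next
  case (Suc l)
  \<comment> \<open>One degree higher, the leading part itself counts as lower, so off-diagonal steps are harmless.\<close>
  have all: "X (pbw l 0 0) k j \<in> lower (Suc l) 0" if "k < p" for k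
  proof -
    have "lead l 0 0 k j \<in> lower (Suc l) 0"
      by (simp add: lead_def lower_zero lower_scale pbw_lower)
    with lower_mono[OF Suc.IH[OF that Suc.prems(2)], of "Suc l" 0]
    show ?thesis using lower_add[of "X (pbw l 0 0) k j - lead l 0 0 k j" "Suc l" 0] by fastforce
  qed
  have "X (pbw (Suc l) 0 0) i j - lead (Suc l) 0 0 i j =
      scale (\<beta> i) (F * (X (pbw l 0 0) i j - lead l 0 0 i j)) +
      (if i = 0 then 0 else K ^ r * X (pbw l 0 0) (i - 1) j)"
    using Suc.prems
    by (simp add: F_pbw[symmetric] X_F_left lead_def right_diff_distrib scale_right_diff_distrib
        scale_mult_right)
  moreover have "\<dots> \<in> lower (Suc l) 0"
    using Suc all by (auto intro!: lower_add lower_scale lower_zero F_lower K_lower)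
  ultimately show ?case by simp
qed

lemma leading_term_FE:
  "i < p \<Longrightarrow> j < p \<Longrightarrow> X (pbw l m 0) i j - lead l m 0 i j \<in> lower l m"
proof (induction m arbitrary: j)
  case 0
  then show ?case by (rule leading_term_F)
next
  case (Suc m)
  have all: "X (pbw l m 0) i k \<in> lower l (Suc m)" if "k < p" for k
  proof -
    have "lead l m 0 i k \<in> lower l (Suc m)"
      by (simp add: lead_def lower_zero lower_scale pbw_lower)
    with lower_mono[OF Suc.IH[OF Suc.prems(1) that], of l "Suc m"]
    show ?thesis using lower_add[of "X (pbw l m 0) i k - lead l m 0 i k" l "Suc m"] by fastforce
  qed
  have *: "pbw l (Suc m) 0 = pbw l m 0 * E" by (simp add: pbw_E)
  have "X (pbw l (Suc m) 0) i j - lead l (Suc m) 0 i j =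
      scale (\<alpha> j) ((X (pbw l m 0) i j - lead l m 0 i j) * E) +
      (if j = 0 then 0 else scale (c j) (X (pbw l m 0) i (j - 1) * K ^ s))"
    using Suc.prems
    by (simp add: * X_E_right lead_def left_diff_distrib scale_right_diff_distrib
        scale_mult_left mult.left_commute)
  moreover have "\<dots> \<in> lower l (Suc m)"
    using Suc all by (auto intro!: lower_add lower_scale lower_zero lower_E lower_K)
  ultimately show ?case by simp
qed

lemma leading_term:
  assumes "i < p" "j < p"
  shows "X (pbw l m n) i j - lead l m n i j \<in> lower l m"
proof -
  have *: "pbw l m n = pbw l m 0 * K ^ n" by (simp add: pbw_def)
  have "X (pbw l m n) i j - lead l m n i j = scale (\<kappa> j ^ n) ((X (pbw l m 0) i j - lead l m 0 i j) * K ^ n)"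
    using assms
    by (simp add: * X_K_power_right lead_def left_diff_distrib scale_right_diff_distrib
        scale_mult_left mult.commute)
  with leading_term_FE[OF assms] show ?thesis by (simp add: lower_scale lower_K)
qed

end

section \<open>The Steinberg module\<close>

locale steinberg_module =
  restricted_quantum_sl2_at_root scale \<Delta> \<epsilon> S p q E F K + algebra_module scale scaleV act
  for scale :: "'k::field \<Rightarrow> 'h::ring_1 \<Rightarrow> 'h"
    and \<Delta> :: "'h \<Rightarrow> ('h \<times> 'h) multiset" and \<epsilon> :: "'h \<Rightarrow> 'k" and S :: "'h \<Rightarrow> 'h"
    and p :: nat and q :: 'k and E F K :: 'h
    and scaleV :: "'k \<Rightarrow> 'v::ab_group_add \<Rightarrow> 'v" and act :: "'h \<Rightarrow> 'v \<Rightarrow> 'v" +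
  fixes v :: "nat \<Rightarrow> 'v"
  assumes inj_v: "inj_on v {..<p}"
    and indep_v: "V.independent (v ` {..<p})"
    and span_v: "V.span (v ` {..<p}) = UNIV"
    and act_K: "n < p \<Longrightarrow> act K (v n) = scaleV (q powi (int p - 1 - 2 * int n)) (v n)"
    and act_E: "n < p \<Longrightarrow> act E (v n) =
      (if n = 0 then 0 else scaleV (q_int q n * q_int q (p - n)) (v (n - 1)))"
    and act_F: "n < p \<Longrightarrow> act F (v n) = (if n = p - 1 then 0 else v (n + 1))"
begin

text \<open>The eigenvalue of \<open>K\<close> on \<open>v\<^sub>i\<close>, and the coefficient of \<open>E v\<^sub>i\<close>.\<close>

definition weight :: "nat \<Rightarrow> 'k" where "weight i = q powi (int p - 1 - 2 * int i)"
definition raise :: "nat \<Rightarrow> 'k" where "raise i = q_int q i * q_int q (p - i)"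

lemma q_power_double_neq_one: "0 < m \<Longrightarrow> m < p \<Longrightarrow> (q ^ 2) ^ m \<noteq> 1"
  using q_root by (simp add: primitive_root_of_unity_def flip: power_mult)

lemma weight_nonzero: "weight i \<noteq> 0"
  by (simp add: weight_def q_nonzero)

lemma weight_shift: "weight i = (q ^ 2) ^ d * weight (i + d)"
proof -
  have "(q ^ 2) ^ d = q powi (2 * int d)"
    by (simp add: power_int_def nat_mult_distrib flip: power_mult)
  then show ?thesis
    by (simp add: weight_def q_nonzero algebra_simps flip: power_int_add)
qed

lemma weight_inj:
  assumes "i < p" "j < p" "weight i = weight j"
  shows "i = j"
proof -
  have "\<not> (i < j \<and> weight i = weight j)" if "j < p" for i j
    using weight_shift[of i "j - i"] q_power_double_neq_one[of "j - i"] weight_nonzero[of j] that by auto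
  then show ?thesis using assms by (metis linorder_neqE_nat)
qed

lemma weight_power: "weight i ^ (2 * p) = 1"
proof -
  have "q ^ (2 * p) = 1" using q_root by (simp add: primitive_root_of_unity_def)
  then have "q powi (int (2 * p)) = 1" by (simp only: power_int_of_nat)
  then have "(q powi int (2 * p)) powi (int p - 1 - 2 * int i) = 1" by simp
  then show ?thesis
    by (simp add: weight_def mult.commute flip: power_int_mult power_int_of_nat)
qed

lemma q_int_nonzero: "0 < n \<Longrightarrow> n < p \<Longrightarrow> q_int q n \<noteq> 0"
proof -
  assume n: "0 < n" "n < p"
  have "q ^ m - inverse q ^ m \<noteq> 0" if "0 < m" "m < p" for m
  proof
    assume "q ^ m - inverse q ^ m = 0"
    then have "q ^ m * q ^ m = q ^ m * inverse q ^ m" by simp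
    also have "\<dots> = 1" by (simp add: q_nonzero flip: power_mult_distrib)
    finally show False
      using q_power_double_neq_one[OF that]
      by (simp add: power2_eq_square power_mult_distrib)
  qed
  from this[OF n] this[of 1] p_ge_2 show ?thesis by (simp add: q_int_def)
qed

lemma raise_nonzero: "0 < i \<Longrightarrow> i < p \<Longrightarrow> raise i \<noteq> 0"
  by (simp add: raise_def q_int_nonzero)

lemma act_vadd: "act x (u + w) = act x u + act x w"
  and act_vscale: "act x (scaleV c u) = scaleV c (act x u)"
  using act_linear[of x] by (simp_all add: Vector_Spaces.linear_iff)

lemma act_vsum: "act x (\<Sum>i\<in>A. f i) = (\<Sum>i\<in>A. act x (f i))"
proof -
  have "act x 0 = 0" using act_vadd[of x 0 0] by simp
  then show ?thesis by (induction A rule: infinite_finite_induct) (simp_all add: act_vadd)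
qed

definition coef :: "nat \<Rightarrow> 'v \<Rightarrow> 'k" where
  "coef i x = V.representation (v ` {..<p}) x (v i)"

lemma coef_add: "coef i (x + y) = coef i x + coef i y"
  and coef_scale: "coef i (scaleV a x) = a * coef i x"
  by (simp_all add: coef_def V.representation_add V.representation_scale indep_v span_v)

lemma coef_zero: "coef i 0 = 0"
  by (simp add: coef_def V.representation_zero)

lemma coef_basis: "i < p \<Longrightarrow> j < p \<Longrightarrow> coef i (v j) = (if i = j then 1 else 0)"
  using inj_v by (auto simp: coef_def V.representation_basis indep_v inj_on_def)

lemma coef_expand: "x = (\<Sum>i<p. scaleV (coef i x) (v i))"
proof -
  have "(\<Sum>b\<in>v ` {..<p}. scaleV (V.representation (v ` {..<p}) x b) b) = x"
    by (rule V.sum_representation_eq) (simp_all add: indep_v span_v)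
  then show ?thesis by (simp add: sum.reindex inj_v coef_def)
qed

definition mat :: "'h \<Rightarrow> nat \<Rightarrow> nat \<Rightarrow> 'k" where
  "mat a i j = coef i (act a (v j))"

lemma mat_add: "mat (a + b) i j = mat a i j + mat b i j"
  and mat_scale: "mat (scale x a) i j = x * mat a i j"
  by (simp_all add: mat_def act_add act_scale coef_add coef_scale)

lemma coef_sum: "coef i (\<Sum>k\<in>A. f k) = (\<Sum>k\<in>A. coef i (f k))"
  by (induction A rule: infinite_finite_induct) (simp_all add: coef_add coef_zero)

lemma coef_act: "coef i (act a x) = (\<Sum>k<p. mat a i k * coef k x)"
  by (subst coef_expand[of x]) (simp add: act_vsum act_vscale coef_sum coef_scale mat_def mult.commute)

lemma mat_mult: "mat (a * b) i j = (\<Sum>k<p. mat a i k * mat b k j)"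
  unfolding mat_def[of "a * b"] act_mult coef_act[of i a] mat_def[of b] ..

lemma act_Kinv: "n < p \<Longrightarrow> act Kinv (v n) = scaleV (inverse (weight n)) (v n)"
proof -
  assume n: "n < p"
  have "v n = act Kinv (act K (v n))" by (simp flip: act_mult add: Kinv_K act_one)
  also have "\<dots> = scaleV (weight n) (act Kinv (v n))"
    using n by (simp add: act_K act_vscale weight_def)
  finally have "scaleV (inverse (weight n)) (v n) = scaleV (inverse (weight n)) (scaleV (weight n) (act Kinv (v n)))"
    by simp
  then show ?thesis by (simp add: weight_nonzero)
qed

lemma mat_generators:
  assumes "i < p" "j < p"
  shows "mat 1 i j = (if i = j then 1 else 0)"
    and "mat K i j = (if i = j then weight i else 0)"
    and "mat Kinv i j = (if i = j then inverse (weight i) else 0)"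
    and "mat E i j = (if j = Suc i then raise j else 0)"
    and "mat F i j = (if i = Suc j then 1 else 0)"
  using assms
  by (auto simp: mat_def act_one act_K act_Kinv act_E act_F coef_basis coef_scale coef_zero
      weight_def raise_def)

text \<open>The coproduct matrices: the module is applied to the second leg in \<open>R\<close> and to the first
  leg in \<open>L\<close>. The defining properties of the integral \<open>\<lambda>\<close> of the dual and of the distinguished
  group-like element \<open>g\<close> become \<open>\<lambda> (R a) = \<lambda> a \<cdot> 1\<close> and \<open>\<lambda> (L a) = \<lambda> a \<cdot> g\<close>, entry by
  entry, with \<open>1\<close> and \<open>g\<close> acting on the module.\<close>

definition R :: "'h \<Rightarrow> nat \<Rightarrow> nat \<Rightarrow> 'h" where
  "R a i j = (\<Sum>(a1, a2)\<in>#\<Delta> a. scale (mat a2 i j) a1)"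

definition L :: "'h \<Rightarrow> nat \<Rightarrow> nat \<Rightarrow> 'h" where
  "L a i j = (\<Sum>(a1, a2)\<in>#\<Delta> a. scale (mat a1 i j) a2)"

lemma balanced_R: "balanced scale (\<lambda>a1 a2. scale (mat a2 i j) a1)"
  and balanced_L: "balanced scale (\<lambda>a1 a2. scale (mat a1 i j) a2)"
  by (simp_all add: balanced_def mat_add mat_scale scale_left_distrib scale_right_distrib mult.commute)

lemma R_mult: "R (a * b) i j = (\<Sum>k<p. R a i k * R b k j)"
proof -
  have "R (a * b) i j = (\<Sum>(a1, a2)\<in>#\<Delta> a. \<Sum>(b1, b2)\<in>#\<Delta> b. scale (mat (a2 * b2) i j) (a1 * b1))"
    unfolding R_def by (rule sweedler_mult[OF balanced_R])
  also have "\<dots> = (\<Sum>k<p. R a i k * R b k j)"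
    by (simp add: R_def sum_mset_product case_prod_unfold sum_sum_mset_swap mat_mult scale_sum_left
        scale_mult_left scale_mult_right mult.commute)
  finally show ?thesis .
qed

lemma L_mult: "L (a * b) i j = (\<Sum>k<p. L a i k * L b k j)"
proof -
  have "L (a * b) i j = (\<Sum>(a1, a2)\<in>#\<Delta> a. \<Sum>(b1, b2)\<in>#\<Delta> b. scale (mat (a1 * b1) i j) (a2 * b2))"
    unfolding L_def by (rule sweedler_mult[OF balanced_L])
  also have "\<dots> = (\<Sum>k<p. L a i k * L b k j)"
    by (simp add: L_def sum_mset_product case_prod_unfold sum_sum_mset_swap mat_mult scale_sum_left
        scale_mult_left scale_mult_right mult.commute)
  finally show ?thesis .
qed

sublocale R: coproduct_matrix scale \<Delta> \<epsilon> S p q E F K R weight "\<lambda>_. 1" weight raise "2 * p - 1" 0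
proof
  fix i j a b
  show "R (a * b) i j = (\<Sum>k<p. R a i k * R b k j)" by (rule R_mult)
  assume ij: "i < p" "j < p"
  note ev = tensor2_eq_sum_mset[OF balanced_R]
  show "R 1 i j = (if i = j then 1 else 0)"
    using sweedler_one[OF balanced_R, of i j] ij by (simp add: R_def mat_generators)
  show "R K i j = (if i = j then scale (weight i) K else 0)"
    using ev[OF comult_K, of i j] ij by (simp add: R_def mat_generators)
  show "R F i j = (if i = j then scale 1 F else if i = Suc j then K ^ (2 * p - 1) else 0)"
    using ev[OF comult_F, of i j] ij by (auto simp: R_def mat_generators)
  show "R E i j = (if i = j then scale (weight i) E else if j = Suc i then scale (raise j) (K ^ 0) else 0)"
    using ev[OF comult_E, of i j] ij by (auto simp: R_def mat_generators)
qed

sublocale L: coproduct_matrix scale \<Delta> \<epsilon> S p q E F K L "\<lambda>_. 1" "\<lambda>i. inverse (weight i)" weight raise 0 1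
proof
  fix i j a b
  show "L (a * b) i j = (\<Sum>k<p. L a i k * L b k j)" by (rule L_mult)
  assume ij: "i < p" "j < p"
  note ev = tensor2_eq_sum_mset[OF balanced_L]
  show "L 1 i j = (if i = j then 1 else 0)"
    using sweedler_one[OF balanced_L, of i j] ij by (simp add: L_def mat_generators)
  show "L K i j = (if i = j then scale (weight i) K else 0)"
    using ev[OF comult_K, of i j] ij by (simp add: L_def mat_generators)
  show "L F i j = (if i = j then scale (inverse (weight i)) F else if i = Suc j then K ^ 0 else 0)"
    using ev[OF comult_F[folded Kinv_def], of i j] ij by (auto simp: L_def mat_generators)
  show "L E i j = (if i = j then scale 1 E else if j = Suc i then scale (raise j) (K ^ 1) else 0)"
    using ev[OF comult_E, of i j] ij by (auto simp: L_def mat_generators)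
qed

end

section \<open>The integral of the dual and the distinguished group-like element\<close>

context steinberg_module
begin

text \<open>The coefficient is the geometric sum
  \<open>raise 1 \<cdot> (\<Sum>s<m. weight 0 ^ (m - 1 - s) * weight 1 ^ s)\<close>: one of the \<open>m\<close> factors lowers the index
  from \<open>1\<close> to \<open>0\<close>, the others contribute the weights of \<open>K\<close> before and after that step. For
  \<open>m = 0\<close> it is zero, so the truncated exponent \<open>m - 1\<close> does no harm.\<close>

lemma R_E_power:
  assumes "k < p"
  shows "R (E ^ m) k 1 =
    (if k = 0 then scale (raise 1 * (weight 0 ^ m - weight 1 ^ m) / (weight 0 - weight 1)) (E ^ (m - 1))
     else if k = 1 then scale (weight 1 ^ m) (E ^ m) else 0)"
  using assms
proof (induction m arbitrary: k)
  case 0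
  then show ?case using p_ge_2 by (simp add: R.X_one)
next
  case (Suc m)
  have ne: "weight 0 - weight 1 \<noteq> 0"
    using weight_inj[of 0 1] p_ge_2 by auto
  have IH: "R (E ^ Suc m) k 1 = scale (weight k) (E * R (E ^ m) k 1) +
    (if Suc k < p then scale (raise (Suc k)) (R (E ^ m) (Suc k) 1) else 0)"
    using R.X_E_left[of k 1 "E ^ m"] Suc.prems p_ge_2 by simp
  consider "k = 0" | "k = 1" | "k > 1" by linarith
  then show ?case
  proof cases
    case 1
    define a where "a = raise 1 * (weight 0 ^ m - weight 1 ^ m) / (weight 0 - weight 1)"
    have R01: "R (E ^ m) 0 1 = scale a (E ^ (m - 1))" and R11: "R (E ^ m) 1 1 = scale (weight 1 ^ m) (E ^ m)"
      using Suc.IH[of 0] Suc.IH[of 1] p_ge_2 by (simp_all add: a_def)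
    have "scale a (E * E ^ (m - 1)) = scale a (E ^ m)"
      by (cases m) (simp_all add: a_def)
    then have "R (E ^ Suc m) k 1 = scale (weight 0 * a + raise 1 * weight 1 ^ m) (E ^ m)"
      using IH 1 p_ge_2 R01 R11
      by (simp add: scale_mult_right scale_left_distrib flip: scale_scale del: power_Suc)
    moreover have "weight 0 * a + raise 1 * weight 1 ^ m =
        raise 1 * (weight 0 ^ Suc m - weight 1 ^ Suc m) / (weight 0 - weight 1)"
      using ne by (simp add: a_def divide_simps) (simp add: algebra_simps)
    ultimately show ?thesis using 1 by simp
  next
    case 2
    then show ?thesis
      using IH Suc.IH[of 1] Suc.IH[of 2] p_ge_2 by (auto simp: scale_mult_right numeral_2_eq_2)
  next
    case 3
    then show ?thesis
      using IH Suc.IH[of k] Suc.IH[of "Suc k"] Suc.prems by auto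
  qed
qed

lemma R_F_power_left: "j < p \<Longrightarrow> R (F ^ l * x) 0 j = F ^ l * R x 0 j"
proof (induction l)
  case (Suc l)
  then show ?case using R.X_F_left[of 0 j "F ^ l * x"] p_ge_2 by (simp add: mult.assoc)
qed simp

text \<open>An off-diagonal entry in which the monomial loses exactly one factor \<open>E\<close>, with a coefficient
  that is nonzero for \<open>0 < m < p\<close>. As \<open>\<lambda>\<close> kills off-diagonal entries of \<open>R\<close>, it kills every
  monomial that arises in this way.\<close>

lemma R_pbw_0_1:
  "R (pbw l m n) 0 1 =
    scale (raise 1 * (weight 0 ^ m - weight 1 ^ m) / (weight 0 - weight 1) * weight 1 ^ n) (pbw l (m - 1) n)"
  using p_ge_2 R.X_K_power_right[of 0 1 "F ^ l * E ^ m" n] R_F_power_left[of 1 l "E ^ m"]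
    R_E_power[of 0 m]
  by (simp add: pbw_def scale_mult_left scale_mult_right mult.commute)

lemma R_F_power:
  "R (F ^ l) 0 1 = 0" "R (F ^ l) 1 1 = F ^ l"
  "R (F ^ l) 1 0 = scale ((q ^ 2) ^ l - 1) (scale (inverse (q ^ 2 - 1)) (F ^ (l - 1) * Kinv))"
proof -
  show 01: "R (F ^ l) 0 1 = 0" for l
    using R_F_power_left[of 1 l 1] R.X_one[of 0 1] p_ge_2 by simp
  show 11: "R (F ^ l) 1 1 = F ^ l" for l
  proof (induction l)
    case (Suc l)
    then show ?case using R.X_F_left[of 1 1 "F ^ l"] 01 p_ge_2 by simp
  qed (use p_ge_2 in \<open>simp add: R.X_one\<close>)
  have ne: "q ^ 2 - 1 \<noteq> 0" using q_power_double_neq_one[of 1] p_ge_2 by simp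
  show "R (F ^ l) 1 0 = scale ((q ^ 2) ^ l - 1) (scale (inverse (q ^ 2 - 1)) (F ^ (l - 1) * Kinv))"
  proof (induction l)
    case 0
    then show ?case using p_ge_2 by (simp add: R.X_one)
  next
    case (Suc l)
    let ?a = "((q ^ 2) ^ l - 1) * inverse (q ^ 2 - 1)"
    have "scale ?a (F ^ (l - 1) * Kinv * F) = scale (?a * q ^ 2) (F ^ (l - 1) * F * Kinv)"
      by (simp add: Kinv_F scale_mult_right mult.assoc)
    also have "\<dots> = scale (?a * q ^ 2) (F ^ l * Kinv)"
      by (cases l) (simp_all add: power_commutes)
    finally have "R (F ^ Suc l) 1 0 = scale (?a * q ^ 2 + 1) (F ^ l * Kinv)"
      using R.X_F_right[of 1 0 "F ^ l", folded Kinv_def] 11[of l] Suc p_ge_2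
      by (simp add: scale_mult_left scale_left_distrib power_commutes)
    also have "?a * q ^ 2 + 1 = ((q ^ 2) ^ Suc l - 1) * inverse (q ^ 2 - 1)"
      using ne by (simp add: field_simps)
    finally show ?case by simp
  qed
qed

lemma R_E_power_right: "i < p \<Longrightarrow> R (x * E ^ m) i 0 = scale (weight 0 ^ m) (R x i 0 * E ^ m)"
proof (induction m)
  case (Suc m)
  have "R (x * E ^ Suc m) i 0 = R (x * E ^ m * E) i 0"
    by (simp only: power_Suc2 mult.assoc)
  also have "\<dots> = scale (weight 0) (R (x * E ^ m) i 0 * E)"
    using R.X_E_right[of i 0 "x * E ^ m"] Suc.prems p_ge_2 by simp
  also have "\<dots> = scale (weight 0 ^ Suc m) (R x i 0 * (E ^ m * E))"
    using Suc by (simp add: scale_mult_left mult.assoc)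
  finally show ?case by (simp only: power_Suc2)
qed simp

text \<open>The counterpart for a factor \<open>F\<close>. The exponent of \<open>K\<close> is taken to be positive to
  absorb the inverse of \<open>K\<close> in the coproduct of \<open>F\<close>.\<close>

lemma R_pbw_1_0:
  "R (pbw l m (Suc n)) 1 0 = scale (weight 0 ^ Suc n * (weight 0 ^ m * ((q ^ 2) ^ l - 1) *
      inverse (q ^ 2 - 1) * inverse ((q ^ 2) ^ m))) (pbw (l - 1) m n)"
proof -
  have "F ^ (l - 1) * Kinv * E ^ m * K ^ Suc n = scale (inverse ((q ^ 2) ^ m)) (pbw (l - 1) m n)"
    by (simp add: mult.assoc pbw_def) (simp add: mult.assoc[symmetric] Kinv_E_power scale_mult_left
      scale_mult_right, simp add: mult.assoc K_cancel)
  then show ?thesis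
  using p_ge_2 R.X_K_power_right[of 1 0 "F ^ l * E ^ m" "Suc n"] R_E_power_right[of 1 "F ^ l" m]
    R_F_power(3)[of l]
  by (simp add: pbw_def scale_mult_left scale_mult_right mult.assoc del: power_Suc)
qed

end

locale steinberg_integral =
  steinberg_module scale \<Delta> \<epsilon> S p q E F K scaleV act v
  for scale :: "'k::field \<Rightarrow> 'h::ring_1 \<Rightarrow> 'h"
    and \<Delta> :: "'h \<Rightarrow> ('h \<times> 'h) multiset" and \<epsilon> :: "'h \<Rightarrow> 'k" and S :: "'h \<Rightarrow> 'h"
    and p :: nat and q :: 'k and E F K :: 'h
    and scaleV :: "'k \<Rightarrow> 'v::ab_group_add \<Rightarrow> 'v" and act :: "'h \<Rightarrow> 'v \<Rightarrow> 'v"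
    and v :: "nat \<Rightarrow> 'v" +
  fixes lam :: "'h \<Rightarrow> 'k" and g :: 'h
  assumes integral: "right_integral_dual scale \<Delta> lam"
    and integral_nonzero: "\<exists>a. lam a \<noteq> 0"
    and distinguished: "distinguished_grouplike scale \<Delta> lam g"
begin

lemma lam_add: "lam (x + y) = lam x + lam y"
  and lam_scale: "lam (scale c x) = c * lam x"
  using integral by (simp_all add: right_integral_dual_def Vector_Spaces.linear_iff)

lemma lam_zero: "lam 0 = 0"
  using additive_zero[of lam] lam_add by blast

lemma lam_R:
  assumes "i < p" "j < p"
  shows "lam (R a i j) = (if i = j then lam a else 0)"
proof -
  have "lam (R a i j) = mat (\<Sum>(a1, a2)\<in>#\<Delta> a. scale (lam a1) a2) i j"
    by (simp add: R_def additive_sum_mset[of lam] additive_sum_mset[of "\<lambda>x. mat x i j"] lam_add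
        lam_scale mat_add mat_scale case_prod_unfold mult.commute)
  also have "\<dots> = lam a * mat 1 i j"
    using integral by (simp add: right_integral_dual_def mat_scale)
  finally show ?thesis using assms by (simp add: mat_generators)
qed

lemma lam_L: "lam (L a i j) = lam a * mat g i j"
proof -
  have "lam (L a i j) = mat (\<Sum>(a1, a2)\<in>#\<Delta> a. scale (lam a2) a1) i j"
    by (simp add: L_def additive_sum_mset[of lam] additive_sum_mset[of "\<lambda>x. mat x i j"] lam_add
        lam_scale mat_add mat_scale case_prod_unfold mult.commute)
  then show ?thesis
    using distinguished by (simp add: distinguished_grouplike_def mat_scale)
qed

lemma lam_pbw_E: "Suc m < p \<Longrightarrow> lam (pbw l m n) = 0"
proof -
  assume m: "Suc m < p"
  have "weight 0 ^ Suc m - weight 1 ^ Suc m \<noteq> 0"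
    using weight_shift[of 0 1] weight_nonzero[of 1] q_power_double_neq_one[of "Suc m"] m
    by (simp add: power_mult_distrib del: power_Suc)
  moreover have "weight 0 - weight 1 \<noteq> 0" "raise 1 \<noteq> 0"
    using weight_inj[of 0 1] p_ge_2 raise_nonzero[of 1] by auto
  moreover have "lam (R (pbw l (Suc m) n) 0 1) = 0"
    using lam_R[of 0 1] p_ge_2 by simp
  ultimately show ?thesis
    unfolding R_pbw_0_1 by (simp add: lam_scale weight_nonzero)
qed

lemma lam_pbw_F: "Suc l < p \<Longrightarrow> lam (pbw l m n) = 0"
proof -
  assume l: "Suc l < p"
  have "(q ^ 2) ^ Suc l - 1 \<noteq> 0" "q ^ 2 - 1 \<noteq> 0"
    using q_power_double_neq_one[of "Suc l"] q_power_double_neq_one[of 1] l by simp_all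
  moreover have "lam (R (pbw (Suc l) m (Suc n)) 1 0) = 0"
    using lam_R[of 1 0] p_ge_2 by simp
  ultimately show ?thesis
    unfolding R_pbw_1_0 by (simp add: lam_scale weight_nonzero q_nonzero)
qed

lemma lam_lower: "x \<in> lower (p - 1) (p - 1) \<Longrightarrow> lam x = 0"
  unfolding lower_def
proof (induction rule: span_induct_alt)
  case base
  show ?case using lam_zero by simp
next
  case (step c y z)
  then show ?case using lam_pbw_E lam_pbw_F by (auto simp: lam_add lam_scale)
qed

text \<open>A nonzero functional is nonzero on some ordered monomial, and the only ones left are those with
  both exponents equal to \<open>p - 1\<close>.\<close>

lemma lam_top_nonzero: "\<exists>n. lam (pbw (p - 1) (p - 1) n) \<noteq> 0"
proof (rule ccontr)
  assume top: "\<nexists>n. lam (pbw (p - 1) (p - 1) n) \<noteq> 0"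
  have gen: "lam (pbw l m n) = 0" for l m n
  proof -
    consider "Suc l < p \<or> Suc m < p" | "l \<ge> p \<or> m \<ge> p" | "l = p - 1" "m = p - 1"
      by linarith
    then show ?thesis
    proof cases
      \<comment> \<open>Monomials with a larger exponent are zero since \<open>F^p = E^p = 0\<close>.\<close>
      case 2
      have "F ^ l = 0" if "l \<ge> p" using that F_power by (metis le_add_diff_inverse mult_zero_left power_add)
      moreover have "E ^ m = 0" if "m \<ge> p" using that E_power by (metis le_add_diff_inverse mult_zero_left power_add)
      ultimately have "pbw l m n = 0" using 2 by (auto simp: pbw_def)
      then show ?thesis using lam_zero by simp
    qed (use top lam_pbw_E lam_pbw_F in auto)
  qed
  have "lam h = 0" for h
    using pbw_span[of h]
  proof (induction rule: span_induct_alt)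
    case base
    show ?case using lam_zero by simp
  qed (auto simp: lam_add lam_scale gen)
  with integral_nonzero show False by simp
qed

text \<open>For the top monomial \<open>b = F^(p-1) E^(p-1) K^n\<close> on which \<open>\<lambda>\<close> does not vanish, only leading
  terms survive under \<open>\<lambda>\<close>. The diagonal entries of \<open>R b\<close> give \<open>weight j ^ (p - 1 + n) = 1\<close>, those of
  \<open>L b\<close> give the eigenvalue \<open>weight j ^ (n - (p - 1))\<close> of \<open>g\<close>. The quotient of these two powers is
  \<open>weight j ^ (2 - 2 p)\<close>, which is \<open>weight j ^ 2\<close>: on the module, \<open>g\<close> acts as \<open>K^2\<close>.\<close>

lemma mat_g:
  assumes "i < p" "j < p"
  shows "mat g i j = (if i = j then weight j ^ 2 else 0)"
proof -
  obtain n where n: "lam (pbw (p - 1) (p - 1) n) \<noteq> 0"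
    using lam_top_nonzero by blast
  let ?b = "pbw (p - 1) (p - 1) n"
  have "lam (x - y) = lam x - lam y" for x y
    using lam_add[of "x - y" y] by simp
  then have eq: "lam x = lam y" if "x - y \<in> lower (p - 1) (p - 1)" for x y
    using lam_lower[OF that] by simp
  have "lam (R ?b j j) = lam (R.lead (p - 1) (p - 1) n j j)"
    by (rule eq) (use R.leading_term assms in blast)
  then have "lam ?b = weight j ^ (p - 1) * weight j ^ n * lam ?b"
    using assms by (simp add: lam_R R.lead_def lam_scale)
  then have 1: "weight j ^ (p - 1) * weight j ^ n = 1" using n by simp
  have "lam (L ?b i j) = lam (L.lead (p - 1) (p - 1) n i j)"
    by (rule eq) (use L.leading_term assms in blast)
  then have "mat g i j * lam ?b = (if i = j then inverse (weight j) ^ (p - 1) * weight j ^ n * lam ?b else 0)"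
    using lam_zero by (auto simp: lam_L L.lead_def lam_scale mult.commute)
  then have 2: "mat g i j = (if i = j then inverse (weight j) ^ (p - 1) * weight j ^ n else 0)"
    using n by (auto split: if_splits)
  have "weight j ^ n = inverse (weight j ^ (p - 1))"
    using 1 by (metis inverse_unique)
  moreover have "2 * p = 2 + (p - 1) + (p - 1)" using p_ge_2 by simp
  then have "weight j ^ 2 * weight j ^ (p - 1) * weight j ^ (p - 1) = weight j ^ (2 * p)"
    by (simp only: power_add)
  then have "weight j ^ 2 * weight j ^ (p - 1) * weight j ^ (p - 1) = 1"
    by (simp add: weight_power)
  then have "weight j ^ 2 = inverse (weight j ^ (p - 1)) * inverse (weight j ^ (p - 1))"
    using weight_nonzero[of j] by (simp add: field_simps)
  ultimately show ?thesis by (simp add: 2 power_inverse)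
qed

lemma act_g: "j < p \<Longrightarrow> act g (v j) = scaleV (weight j ^ 2) (v j)"
  by (subst coef_expand) (simp add: mat_g flip: mat_def cong: if_cong, simp add: if_distrib[of "\<lambda>x. scaleV x _"] cong: if_cong)

lemma act_g_inverse: "j < p \<Longrightarrow> act (mult_inverse g) (v j) = scaleV (inverse (weight j ^ 2)) (v j)"
proof -
  assume j: "j < p"
  have gl: "grouplike scale \<Delta> g"
    using distinguished by (simp add: distinguished_grouplike_def)
  have "v j = act (mult_inverse g) (act g (v j))"
    by (simp flip: act_mult add: grouplike_inverse[OF gl] act_one)
  also have "\<dots> = scaleV (weight j ^ 2) (act (mult_inverse g) (v j))"
    using j by (simp add: act_g act_vscale)
  finally have "scaleV (inverse (weight j ^ 2)) (v j) =
      scaleV (inverse (weight j ^ 2)) (scaleV (weight j ^ 2) (act (mult_inverse g) (v j)))"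
    by simp
  then show ?thesis by (simp add: weight_nonzero)
qed

end

section \<open>The adjoint action of the integral on endomorphisms\<close>

context restricted_quantum_sl2_at_root
begin

definition Lam :: 'h where
  "Lam = F ^ (p - 1) * E ^ (p - 1) * (\<Sum>j = 0..2 * p - 1. K ^ j)"

lemma Lam_alt: "Lam = F ^ (p - 1) * E ^ (p - 1) * (\<Sum>j<2 * p. K ^ j)"
proof -
  have "{0..2 * p - 1} = {..<2 * p}" using p_ge_2 by auto
  then show ?thesis by (simp only: Lam_def)
qed

lemma K_sum_K: "K * (\<Sum>j<2 * p. K ^ j) = (\<Sum>j<2 * p. K ^ j)"
proof -
  have "K * (\<Sum>j<2 * p. K ^ j) + 1 = (\<Sum>j<Suc (2 * p). K ^ j)"
    unfolding sum.lessThan_Suc_shift by (simp add: sum_distrib_left)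
  then show ?thesis by (simp add: K_power)
qed

lemma sum_K_K: "(\<Sum>j<2 * p. K ^ j) * K = (\<Sum>j<2 * p. K ^ j)"
  using K_sum_K by (simp add: sum_distrib_left sum_distrib_right power_commutes)

lemma Lam_K: "Lam * K = Lam"
  by (simp only: Lam_alt mult.assoc sum_K_K)

lemma K_Lam: "K * Lam = Lam"
proof -
  have "K * (F ^ (p - 1) * E ^ (p - 1)) = F ^ (p - 1) * E ^ (p - 1) * K"
    unfolding mult.assoc[symmetric] K_F_power
    by (simp add: scale_mult_left scale_mult_right mult.assoc K_E_power q_nonzero
        flip: power_mult_distrib)
  then show ?thesis
    by (simp only: Lam_alt mult.assoc[symmetric]) (simp only: mult.assoc K_sum_K)
qed

lemma F_Lam: "F * Lam = 0"
proof -
  have "F * F ^ (p - 1) = 0" using F_power p_ge_2 by (simp flip: power_Suc)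
  then show ?thesis by (simp add: Lam_def mult.assoc[symmetric])
qed

lemma Lam_E: "Lam * E = 0"
proof -
  have "E ^ (p - 1) * E = 0" using E_power p_ge_2 by (simp flip: power_Suc2)
  then have "F ^ (p - 1) * E ^ (p - 1) * (K ^ j * E) = 0" for j
    by (simp add: K_power_E scale_mult_right) (simp add: mult.assoc[symmetric], simp add: mult.assoc)
  then show ?thesis
    by (simp add: Lam_alt mult.assoc sum_distrib_left sum_distrib_right)
qed

end

context steinberg_module
begin

abbreviation "endo \<equiv> Vector_Spaces.linear scaleV scaleV"

lemma endo_add: "endo Z \<Longrightarrow> Z (x + y) = Z x + Z y"
  and endo_scale: "endo Z \<Longrightarrow> Z (scaleV a x) = scaleV a (Z x)"
  by (simp_all add: Vector_Spaces.linear_iff)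

lemma endoI:
  "(\<And>x y. Z (x + y) = Z x + Z y) \<Longrightarrow> (\<And>a x. Z (scaleV a x) = scaleV a (Z x)) \<Longrightarrow> endo Z"
  using V.vector_space_axioms by (simp add: Vector_Spaces.linear_iff)

lemma endo_zero: "endo Z \<Longrightarrow> Z 0 = 0"
  using endo_add[of Z 0 0] by simp

lemma endo_minus: "endo Z \<Longrightarrow> Z (- x) = - Z x"
  using endo_scale[of Z "-1" x] by simp

lemma endo_sum: "endo Z \<Longrightarrow> Z (\<Sum>i\<in>A. f i) = (\<Sum>i\<in>A. Z (f i))"
  by (induction A rule: infinite_finite_induct) (simp_all add: endo_add endo_zero)

lemmas act_simps = act_add act_scale act_one act_mult act_vadd act_vscale

lemma act_vzero: "act a 0 = 0"
  using act_linear by (rule endo_zero)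

lemma act_uminus: "act (- a) x = - act a x"
  using act_scale[of "-1" a x] by simp

lemma act_vminus: "act a (- x) = - act a x"
  using act_linear by (rule endo_minus)

lemma act_Kinv_K: "act Kinv (act K x) = x"
  by (simp flip: act_mult add: Kinv_K act_one)

text \<open>The adjoint action \<open>a \<cdot> Z = a\<^sub>1 Z S(a\<^sub>2)\<close> of \<open>H\<close> on the endomorphisms of the module.
  Its invariants are the module endomorphisms.\<close>

definition adj :: "'h \<Rightarrow> ('v \<Rightarrow> 'v) \<Rightarrow> 'v \<Rightarrow> 'v" where
  "adj a Z x = (\<Sum>(a1, a2)\<in>#\<Delta> a. act a1 (Z (act (S a2) x)))"

lemma balanced_adj: "endo Z \<Longrightarrow> balanced scale (\<lambda>a1 a2. act a1 (Z (act (S a2) x)))"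
  by (simp add: balanced_def act_simps S_add S_scale endo_add endo_scale)

lemma adj_one: "endo Z \<Longrightarrow> adj 1 Z x = Z x"
  using sweedler_one[OF balanced_adj] by (simp add: adj_def S_one act_one)

lemma adj_add: "endo Z \<Longrightarrow> adj (a + b) Z x = adj a Z x + adj b Z x"
  using sweedler_add[OF balanced_adj] by (simp add: adj_def)

lemma adj_zero: "endo Z \<Longrightarrow> adj 0 Z x = 0"
  using sweedler_zero[OF balanced_adj] by (simp add: adj_def)

lemma adj_sum: "endo Z \<Longrightarrow> adj (\<Sum>i\<in>A. f i) Z x = (\<Sum>i\<in>A. adj (f i) Z x)"
  by (induction A rule: infinite_finite_induct) (simp_all add: adj_add adj_zero)

text \<open>That this is an action rests on the antipode reversing products.\<close>

lemma adj_mult: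
  assumes "endo Z"
  shows "adj (a * b) Z = adj a (adj b Z)"
proof
  fix x
  have "adj (a * b) Z x = (\<Sum>(a1, a2)\<in>#\<Delta> a. \<Sum>(b1, b2)\<in>#\<Delta> b.
      act (a1 * b1) (Z (act (S (a2 * b2)) x)))"
    unfolding adj_def by (rule sweedler_mult[OF balanced_adj[OF assms]])
  then show "adj (a * b) Z x = adj a (adj b Z) x"
    by (simp add: adj_def S_mult act_mult additive_sum_mset[of "act _"] act_vadd case_prod_unfold)
qed

lemma adj_scale_endo: "adj a (\<lambda>x. scaleV c (Z x)) x = scaleV c (adj a Z x)"
  by (simp add: adj_def act_vscale additive_sum_mset[of "scaleV c"] V.scale_right_distrib case_prod_unfold)

lemma adj_add_endo: "adj a (\<lambda>x. Z x + Y x) x = adj a Z x + adj a Y x"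
  by (simp add: adj_def act_vadd sum_mset.distrib case_prod_unfold)

lemma adj_sum_endo: "adj a (\<lambda>x. \<Sum>k\<in>A. Z k x) x = (\<Sum>k\<in>A. adj a (Z k) x)"
  by (simp add: adj_def act_vsum sum_sum_mset_swap case_prod_unfold)

lemma endo_adj:
  assumes Z: "endo Z"
  shows "endo (adj a Z)"
  by (rule endoI) (simp_all add: adj_def act_simps endo_add[OF Z] endo_scale[OF Z] sum_mset.distrib
      case_prod_unfold additive_sum_mset[of "scaleV _"] V.scale_right_distrib)

lemma adj_K: "endo Z \<Longrightarrow> adj K Z x = act K (Z (act Kinv x))"
  using tensor2_eq_sum_mset[OF balanced_adj comult_K] by (simp add: adj_def antipode_Kinv)

lemma adj_E: "endo Z \<Longrightarrow> adj E Z x = act E (Z (act Kinv x)) - Z (act E (act Kinv x))"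
  using tensor2_eq_sum_mset[OF balanced_adj comult_E, of Z x]
  by (simp add: adj_def antipode_Kinv antipode_Einv act_one act_uminus act_mult endo_minus)

lemma adj_F: "endo Z \<Longrightarrow> adj F Z x = act F (Z x) - act Kinv (Z (act K (act F x)))"
  using tensor2_eq_sum_mset[OF balanced_adj comult_F[folded Kinv_def], of Z x]
  by (simp add: adj_def antipode_F S_one act_one act_uminus act_vminus act_mult endo_minus)

lemma act_F_Suc: "Suc n < p \<Longrightarrow> act F (v n) = v (Suc n)"
  by (auto simp: act_F)

lemma act_F_last: "act F (v (p - 1)) = 0"
  using p_ge_2 by (simp add: act_F)

text \<open>The scalar by which the endomorphism \<open>\<Lambda> \<cdot> Z\<close> acts, read off at \<open>v\<^sub>0\<close>. As
  shown below, it is a multiple of the quantum trace \<open>tr (K Z)\<close>.\<close>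

definition trace_form :: "('v \<Rightarrow> 'v) \<Rightarrow> 'k" where
  "trace_form Z = coef 0 (adj Lam Z (v 0))"

lemma v_eqI: "(\<And>i. i < p \<Longrightarrow> coef i x = coef i y) \<Longrightarrow> x = y"
  by (subst coef_expand[of x], subst coef_expand[of y]) simp

lemma coef_act_K: "i < p \<Longrightarrow> coef i (act K x) = weight i * coef i x"
  and coef_act_Kinv: "i < p \<Longrightarrow> coef i (act Kinv x) = inverse (weight i) * coef i x"
  and coef_act_E: "i < p \<Longrightarrow> coef i (act E x) = (if Suc i < p then raise (Suc i) * coef (Suc i) x else 0)"
  by (simp_all add: coef_act mat_generators if_distrib[of "\<lambda>y. y * _"] cong: if_cong)

text \<open>Since \<open>K \<Lambda> = \<Lambda>\<close> and \<open>F \<Lambda> = 0\<close>, the endomorphism \<open>\<Lambda> \<cdot> Z\<close> commutes with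
  \<open>K\<close> and \<open>F\<close>. It therefore preserves the line of \<open>v\<^sub>0\<close>, because the weights are distinct, and
  \<open>F\<close> carries the same scalar to all of the basis.\<close>

lemma adj_Lam_scalar:
  assumes Z: "endo Z"
  shows "adj Lam Z x = scaleV (trace_form Z) x"
proof -
  define Y where "Y = adj Lam Z"
  have Y: "endo Y" using endo_adj[OF Z] by (simp add: Y_def)
  have K: "act K (Y (act Kinv x)) = Y x" for x
    using adj_K[OF Y, of x] adj_mult[OF Z, of K Lam] by (simp add: Y_def K_Lam)
  have F: "act F (Y x) = Y (act F x)" for x
  proof -
    have "adj F Y x = adj (F * Lam) Z x" by (simp only: adj_mult[OF Z] Y_def)
    then have "adj F Y x = 0" by (simp only: F_Lam adj_zero[OF Z])
    then have "act F (Y x) = act Kinv (Y (act K (act F x)))" by (simp add: adj_F[OF Y])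
    also have "\<dots> = act Kinv (act K (Y (act Kinv (act K (act F x)))))"
      by (simp only: K)
    finally show ?thesis by (simp add: act_Kinv_K)
  qed
  have p: "0 < p" using p_ge_2 by simp
  have v0: "Y (v 0) = scaleV (trace_form Z) (v 0)"
  proof (rule v_eqI)
    fix i assume i: "i < p"
    have "weight i * (inverse (weight 0) * coef i (Y (v 0))) = coef i (Y (v 0))"
      using arg_cong[OF K[of "v 0"], of "coef i"] i p
      by (simp add: coef_act_K act_Kinv endo_scale[OF Y] coef_scale)
    then have "(weight i - weight 0) * coef i (Y (v 0)) = 0"
      using weight_nonzero[of 0] by (simp add: field_simps)
    then have "coef i (Y (v 0)) = 0" if "i \<noteq> 0"
      using weight_inj[of i 0] i p that by auto
    then show "coef i (Y (v 0)) = coef i (scaleV (trace_form Z) (v 0))"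
      using i p by (auto simp: coef_scale coef_basis trace_form_def Y_def)
  qed
  have vn: "n < p \<Longrightarrow> Y (v n) = scaleV (trace_form Z) (v n)" for n
  proof (induction n)
    case (Suc n)
    then show ?case using F[of "v n"] by (simp add: act_F_Suc act_vscale)
  qed (rule v0)
  have "Y x = Y (\<Sum>i<p. scaleV (coef i x) (v i))"
    using coef_expand[of x] by simp
  also have "\<dots> = (\<Sum>i<p. scaleV (coef i x) (scaleV (trace_form Z) (v i)))"
    by (simp add: endo_sum[OF Y] endo_scale[OF Y] vn)
  also have "\<dots> = scaleV (trace_form Z) (\<Sum>i<p. scaleV (coef i x) (v i))"
    by (simp add: V.scale_sum_right mult.commute)
  finally show ?thesis
    using coef_expand[of x] by (simp add: Y_def)
qed

definition matrix_unit :: "nat \<Rightarrow> nat \<Rightarrow> 'v \<Rightarrow> 'v" where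
  "matrix_unit i j x = scaleV (coef j x) (v i)"

lemma endo_matrix_unit: "endo (matrix_unit i j)"
  by (rule endoI) (simp_all add: matrix_unit_def coef_add coef_scale V.scale_left_distrib)

lemma adj_K_matrix_unit:
  "i < p \<Longrightarrow> j < p \<Longrightarrow> adj K (matrix_unit i j) x = scaleV (weight i * inverse (weight j)) (matrix_unit i j x)"
  by (simp add: adj_K endo_matrix_unit matrix_unit_def coef_act_Kinv act_vscale act_K weight_def mult.commute mult.left_commute)

lemma trace_form_scale: "trace_form (\<lambda>x. scaleV c (Z x)) = c * trace_form Z"
  and trace_form_add: "trace_form (\<lambda>x. Z x + Y x) = trace_form Z + trace_form Y"
  and trace_form_sum: "trace_form (\<lambda>x. \<Sum>k\<in>A. X k x) = (\<Sum>k\<in>A. trace_form (X k))"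
  by (simp_all add: trace_form_def adj_scale_endo adj_add_endo adj_sum_endo coef_scale coef_add coef_sum)

lemma trace_form_adj_K: "endo Z \<Longrightarrow> trace_form (adj K Z) = trace_form Z"
  by (simp add: trace_form_def Lam_K flip: adj_mult)

lemma trace_form_adj_E: "endo Z \<Longrightarrow> trace_form (adj E Z) = 0"
  by (simp add: trace_form_def Lam_E adj_zero coef_zero flip: adj_mult)

text \<open>A matrix unit off the diagonal is an eigenvector of \<open>K\<close> with eigenvalue different from
  \<open>1\<close>, whereas \<open>\<Lambda> K = \<Lambda>\<close> makes the form invariant under \<open>K\<close>.\<close>

lemma trace_form_matrix_unit_off_diagonal:
  assumes "i < p" "j < p" "i \<noteq> j"
  shows "trace_form (matrix_unit i j) = 0"
proof -
  have "adj K (matrix_unit i j) = (\<lambda>x. scaleV (weight i * inverse (weight j)) (matrix_unit i j x))"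
    using adj_K_matrix_unit assms by auto
  then have "weight i * inverse (weight j) * trace_form (matrix_unit i j) = trace_form (matrix_unit i j)"
    using trace_form_adj_K[OF endo_matrix_unit, of i j] by (simp add: trace_form_scale)
  then have "(weight i - weight j) * trace_form (matrix_unit i j) = 0"
    using weight_nonzero[of j] by (simp add: field_simps)
  then show ?thesis using weight_inj[of i j] assms by auto
qed

definition trace_const :: 'k where "trace_const = trace_form (matrix_unit 0 0) / weight 0"

text \<open>Because \<open>\<Lambda> E = 0\<close>, the form vanishes on \<open>E \<cdot> Z\<close>. For the matrix unit \<open>Z\<close> in
  position \<open>(i + 1, i)\<close> this is a two-term relation between neighbouring diagonal matrix units; it
  forces their values to be proportional to the weights.\<close>

lemma trace_form_matrix_unit_diagonal: "i < p \<Longrightarrow> trace_form (matrix_unit i i) = trace_const * weight i"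
proof (induction i)
  case 0
  show ?case by (simp add: trace_const_def weight_nonzero)
next
  case (Suc i)
  define c d where "c = raise (Suc i) * inverse (weight i)"
    and "d = - (raise (Suc i) * inverse (weight (Suc i)))"
  have "adj E (matrix_unit (Suc i) i) x = scaleV c (matrix_unit i i x) + scaleV d (matrix_unit (Suc i) (Suc i) x)" for x
    using Suc.prems
    by (simp add: adj_E[OF endo_matrix_unit])
      (simp add: matrix_unit_def act_vscale act_E coef_act_E coef_act_Kinv raise_def c_def d_def mult_ac)
  then have "adj E (matrix_unit (Suc i) i) = (\<lambda>x. scaleV c (matrix_unit i i x) + scaleV d (matrix_unit (Suc i) (Suc i) x))"
    by (rule ext)
  then have "c * trace_form (matrix_unit i i) + d * trace_form (matrix_unit (Suc i) (Suc i)) = 0"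
    using trace_form_adj_E[OF endo_matrix_unit, of "Suc i" i] by (simp only: trace_form_add trace_form_scale)
  then show ?case
    using Suc raise_nonzero[of "Suc i"] weight_nonzero[of i] weight_nonzero[of "Suc i"]
    by (simp add: c_def d_def field_simps)
qed

lemma trace_form_eq:
  assumes "endo Z"
  shows "trace_form Z = (\<Sum>i<p. trace_const * weight i * coef i (Z (v i)))"
proof -
  have "Z x = (\<Sum>j<p. \<Sum>i<p. scaleV (coef i (Z (v j))) (matrix_unit i j x))" for x
  proof -
    have "Z x = (\<Sum>j<p. scaleV (coef j x) (Z (v j)))"
      by (subst coef_expand[of x]) (simp add: endo_sum[OF assms] endo_scale[OF assms])
    also have "\<dots> = (\<Sum>j<p. scaleV (coef j x) (\<Sum>i<p. scaleV (coef i (Z (v j))) (v i)))"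
      using coef_expand by simp
    finally show ?thesis by (simp add: matrix_unit_def V.scale_sum_right mult.commute)
  qed
  then have "trace_form Z = trace_form (\<lambda>x. \<Sum>j<p. \<Sum>i<p. scaleV (coef i (Z (v j))) (matrix_unit i j x))"
    by (intro arg_cong[of _ _ trace_form] ext)
  also have "\<dots> = (\<Sum>j<p. \<Sum>i<p. coef i (Z (v j)) * trace_form (matrix_unit i j))"
    by (simp only: trace_form_sum trace_form_scale)
  also have "\<dots> = (\<Sum>j<p. \<Sum>i<p. if i = j then trace_const * weight i * coef i (Z (v i)) else 0)"
    by (intro sum.cong refl) (auto simp: trace_form_matrix_unit_diagonal trace_form_matrix_unit_off_diagonal)
  finally show ?thesis by simp
qed

lemma adj_K_power_matrix_unit: "adj (K ^ n) (matrix_unit 0 0) = matrix_unit 0 0"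
proof (induction n)
  case (Suc n)
  have "adj K (matrix_unit 0 0) = matrix_unit 0 0"
    using p_ge_2 weight_nonzero by (simp add: adj_K_matrix_unit fun_eq_iff)
  with Suc show ?case by (simp only: power_Suc adj_mult[OF endo_matrix_unit])
qed (simp add: adj_one endo_matrix_unit fun_eq_iff)

text \<open>The first term of the adjoint action of \<open>E\<close> vanishes because \<open>E v\<^sub>0 = 0\<close>, so each step only
  moves the column index.\<close>

lemma adj_E_power_matrix_unit:
  "m < p \<Longrightarrow> adj (E ^ m) (matrix_unit 0 0) =
    (\<lambda>x. scaleV (\<Prod>s = 1..m. - (raise s * inverse (weight s))) (matrix_unit 0 m x))"
proof (induction m)
  case (Suc m)
  have "adj E (matrix_unit 0 m) x = scaleV (- (raise (Suc m) * inverse (weight (Suc m)))) (matrix_unit 0 (Suc m) x)" for x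
    using Suc.prems
    by (simp add: adj_E[OF endo_matrix_unit]) (simp add: matrix_unit_def act_vscale act_E coef_act_E coef_act_Kinv mult_ac)
  moreover have "adj (E ^ Suc m) (matrix_unit 0 0) x =
      scaleV (\<Prod>s = 1..m. - (raise s * inverse (weight s))) (adj E (matrix_unit 0 m) x)" for x
    using Suc by (simp only: power_Suc adj_mult[OF endo_matrix_unit] adj_scale_endo Suc_lessD)
  ultimately show ?case
    by (simp add: fun_eq_iff mult.commute)
qed (simp add: adj_one endo_matrix_unit fun_eq_iff)

text \<open>Evaluated at \<open>v\<close> with index \<open>p - 1\<close>, which \<open>F\<close> kills, the second term of the adjoint action of
  \<open>F\<close> vanishes, and only the image moves down.\<close>

lemma adj_F_power_matrix_unit: "l < p \<Longrightarrow> adj (F ^ l) (matrix_unit 0 (p - 1)) (v (p - 1)) = v l"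
proof (induction l)
  case 0
  then show ?case using p_ge_2 by (simp add: adj_one[OF endo_matrix_unit]) (simp add: matrix_unit_def coef_basis)
next
  case (Suc l)
  have Y: "endo (adj (F ^ l) (matrix_unit 0 (p - 1)))" by (rule endo_adj[OF endo_matrix_unit])
  have "adj (F ^ Suc l) (matrix_unit 0 (p - 1)) (v (p - 1)) = act F (adj (F ^ l) (matrix_unit 0 (p - 1)) (v (p - 1)))"
    by (simp only: power_Suc adj_mult[OF endo_matrix_unit] adj_F[OF Y] act_F_last act_vzero
        endo_zero[OF Y] diff_zero)
  with Suc show ?case by (simp add: act_F_Suc)
qed

text \<open>The normalisation is found by following the matrix unit in position \<open>(0, 0)\<close> through
  \<open>\<Lambda> = F^(p-1) E^(p-1) (\<Sum>j. K^j)\<close>: the sum fixes it up to the factor \<open>2 p\<close>, the power of \<open>E\<close> moves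
  it to position \<open>(0, p - 1)\<close>, and the power of \<open>F\<close> produces an endomorphism, known to be scalar,
  whose value at \<open>v\<close> with index \<open>p - 1\<close> is \<open>v\<close> itself.\<close>

lemma trace_form_matrix_unit_0_0: "trace_form (matrix_unit 0 0) = of_nat (2 * p) * (\<Prod>s = 1..p - 1. - (raise s * inverse (weight s)))"
  (is "_ = _ * ?P")
proof -
  have "adj (\<Sum>j<2 * p. K ^ j) (matrix_unit 0 0) = (\<lambda>x. scaleV (of_nat (2 * p)) (matrix_unit 0 0 x))"
    by (simp add: fun_eq_iff adj_sum endo_matrix_unit adj_K_power_matrix_unit V.sum_constant_scale)
  moreover have "endo (adj a (matrix_unit 0 0))" for a by (rule endo_adj[OF endo_matrix_unit])
  ultimately have "adj Lam (matrix_unit 0 0) (v (p - 1)) =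
      scaleV (of_nat (2 * p)) (scaleV ?P (adj (F ^ (p - 1)) (matrix_unit 0 (p - 1)) (v (p - 1))))"
    using p_ge_2
    by (simp add: Lam_alt adj_mult endo_matrix_unit mult.assoc adj_scale_endo[abs_def] adj_E_power_matrix_unit del: of_nat_mult V.scale_scale)
  then have eq: "scaleV (trace_form (matrix_unit 0 0)) (v (p - 1)) = scaleV (of_nat (2 * p) * ?P) (v (p - 1))"
    using p_ge_2 adj_F_power_matrix_unit[of "p - 1"] by (simp only: adj_Lam_scalar[OF endo_matrix_unit]) simp
  show ?thesis
    using p_ge_2 arg_cong[OF eq, of "coef (p - 1)"] unfolding coef_scale by (simp add: coef_basis)
qed

text \<open>The weights of \<open>v\<^sub>s\<close> and its mirror image are inverse to each other. Only the square of the
  product enters the result, which avoids a sign.\<close>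

lemma prod_weight: "(\<Prod>s<p. weight s) ^ 2 = 1"
proof -
  have "weight s * weight (p - Suc s) = 1" if "s < p" for s
  proof -
    have "int (p - Suc s) = int p - 1 - int s" using that by simp
    then show ?thesis
      using that by (simp add: weight_def q_nonzero algebra_simps flip: power_int_add)
  qed
  then have "(\<Prod>s<p. weight s * weight (p - Suc s)) = 1" by simp
  then show ?thesis
    by (simp add: prod.distrib prod.nat_diff_reindex power2_eq_square)
qed

lemma prod_raise: "(\<Prod>s = 1..p - 1. raise s) = q_fact q (p - 1) ^ 2"
proof -
  have "(\<Prod>s = 1..p - 1. q_int q (p - s)) = q_fact q (p - 1)"
    unfolding q_fact_def
    by (subst prod.atLeastAtMost_rev) (intro prod.cong refl, auto)
  then show ?thesis
    by (simp add: raise_def prod.distrib power2_eq_square q_fact_def)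
qed

lemma trace_const_square: "trace_const ^ 2 = 4 * of_nat p ^ 2 * q_fact q (p - 1) ^ 4"
proof -
  have "{..<p} = insert 0 {1..p - 1}" using p_ge_2 by auto
  then have w: "(\<Prod>s<p. weight s) = weight 0 * (\<Prod>s = 1..p - 1. weight s)" by simp
  have "trace_const ^ 2 = (of_nat (2 * p) * (\<Prod>s = 1..p - 1. raise s)) ^ 2 / (\<Prod>s<p. weight s) ^ 2"
    unfolding trace_const_def trace_form_matrix_unit_0_0 w
    by (simp add: prod_uminus prod.distrib prod_inversef prod_dividef power_mult_distrib power_divide field_simps
        flip: power_mult)
  then show ?thesis
    by (simp only: prod_weight prod_raise) (simp add: power_mult_distrib flip: power_mult)
qed

lemma
  assumes "i < p" "j < p"
  shows mat_conj_K: "mat (K * a * Kinv) i j = weight i * mat a i j * inverse (weight j)"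
    and mat_conj_Kinv: "mat (Kinv * a * K) i j = inverse (weight i) * mat a i j * weight j"
  using assms
  by (simp_all add: mat_def act_mult coef_act_K coef_act_Kinv act_Kinv act_K[folded weight_def] act_vscale coef_scale)

text \<open>An orthogonality relation of Schur type: evaluating the scalar endomorphism \<open>\<Lambda> \<cdot> Z\<close> for
  the matrix unit \<open>Z\<close> in position \<open>(i, n)\<close> gives products of diagonal matrix coefficients of the two
  legs of \<open>\<Lambda>\<close>.\<close>

lemma matrix_orthogonality:
  assumes "i < p" "n < p"
  shows "(\<Sum>(b1, b2)\<in>#\<Delta> Lam. mat b1 i i * mat (S b2) n n) = (if i = n then trace_const * weight n else 0)"
proof -
  have "(\<Sum>(b1, b2)\<in>#\<Delta> Lam. mat b1 i i * mat (S b2) n n) = coef i (adj Lam (matrix_unit i n) (v n))"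
    by (simp add: adj_def matrix_unit_def act_vscale additive_sum_mset[of "coef i"] coef_add coef_scale
        case_prod_unfold mult.commute flip: mat_def)
  also have "\<dots> = trace_form (matrix_unit i n) * (if i = n then 1 else 0)"
    using assms by (simp add: adj_Lam_scalar endo_matrix_unit coef_scale coef_basis)
  finally show ?thesis using assms by (simp add: trace_form_matrix_unit_diagonal)
qed

lemma character_eq: "character scaleV (v ` {..<p}) act x = (\<Sum>n<p. mat x n n)"
  unfolding character_def mat_def coef_def by (simp add: sum.reindex inj_v)

end

section \<open>The character of the commutator\<close>

context steinberg_integral
begin

text \<open>With \<open>S (S x) = K x K\<^sup>-\<^sup>1\<close> and \<open>S\<^sup>-\<^sup>1 x = K\<^sup>-\<^sup>1 S x K\<close> the commutator is the sum over
  the legs \<open>b\<^sub>1\<close>, \<open>b\<^sub>2\<close> of the second \<open>\<Lambda>\<close> of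
  \<open>(\<Lambda> \<cdot> K b\<^sub>1 K\<^sup>-\<^sup>1) K\<^sup>-\<^sup>1 S(b\<^sub>2) K g\<^sup>-\<^sup>1\<close>. The bracket is a scalar, a weighted trace of
  \<open>b\<^sub>1\<close>; conjugation by \<open>K\<close> does not change diagonal entries; the orthogonality relation evaluates
  what is left. The weights \<open>weight n\<close> from the trace form and from the orthogonality relation cancel
  against \<open>g\<^sup>-\<^sup>1\<close>, which is why every diagonal entry is the same.\<close>

lemma mat_commutator:
  assumes n: "n < p"
  shows "mat (commutator \<Delta> S g Lam Lam) n n = trace_const ^ 2"
proof -
  define y where "y = (\<lambda>b2. act (Kinv * S b2 * K) (act (mult_inverse g) (v n)))"
  have "act (commutator \<Delta> S g Lam Lam) (v n) = (\<Sum>(a1, a2)\<in>#\<Delta> Lam. \<Sum>(b1, b2)\<in>#\<Delta> Lam.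
      act a1 (act (K * b1 * Kinv) (act (S a2) (y b2))))"
    by (simp add: commutator_def additive_sum_mset[of "\<lambda>z. act z (v n)"] act_add case_prod_unfold
        S_S inv_S act_mult y_def)
  also have "\<dots> = (\<Sum>(b1, b2)\<in>#\<Delta> Lam. adj Lam (act (K * b1 * Kinv)) (y b2))"
    unfolding adj_def case_prod_unfold by (rule sum_mset.swap)
  also have "\<dots> = (\<Sum>(b1, b2)\<in>#\<Delta> Lam. scaleV (\<Sum>i<p. trace_const * weight i * mat b1 i i) (y b2))"
  proof (rule sum_mset_cong_pair)
    fix b1 b2
    have conj: "mat (K * b1 * Kinv) i i = mat b1 i i" if "i < p" for i
      using weight_nonzero[of i] unfolding mat_conj_K[OF that that] by simp
    have "trace_form (act (K * b1 * Kinv)) = (\<Sum>i<p. trace_const * weight i * mat b1 i i)"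
      by (simp add: trace_form_eq[OF act_linear] conj flip: mat_def)
    then show "adj Lam (act (K * b1 * Kinv)) (y b2) =
        scaleV (\<Sum>i<p. trace_const * weight i * mat b1 i i) (y b2)"
      using adj_Lam_scalar[OF act_linear] by simp
  qed
  finally have act: "act (commutator \<Delta> S g Lam Lam) (v n) =
      (\<Sum>(b1, b2)\<in>#\<Delta> Lam. scaleV (\<Sum>i<p. trace_const * weight i * mat b1 i i) (y b2))" .
  have y: "coef n (y b2) = inverse (weight n ^ 2) * mat (S b2) n n" for b2
    using n weight_nonzero
    by (simp add: y_def act_g_inverse act_vscale coef_scale mat_conj_Kinv flip: mat_def)
  have "mat (commutator \<Delta> S g Lam Lam) n n =
      (\<Sum>(b1, b2)\<in>#\<Delta> Lam. \<Sum>i<p. trace_const * weight i * inverse (weight n ^ 2) * (mat b1 i i * mat (S b2) n n))"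
    unfolding mat_def[of "commutator _ _ _ _ _"] act
    by (simp add: additive_sum_mset[of "coef n"] coef_add coef_scale y case_prod_unfold
        sum_distrib_right sum_distrib_left mult_ac)
  also have "\<dots> = (\<Sum>i<p. trace_const * weight i * inverse (weight n ^ 2) *
      (\<Sum>(b1, b2)\<in>#\<Delta> Lam. mat b1 i i * mat (S b2) n n))"
    by (simp add: sum_mset_distrib_left sum_sum_mset_swap case_prod_unfold)
  also have "\<dots> = (\<Sum>i<p. if i = n then trace_const * weight n * inverse (weight n ^ 2) * (trace_const * weight n) else 0)"
    by (rule sum.cong) (use n matrix_orthogonality in auto)
  also have "\<dots> = trace_const ^ 2"
    using n weight_nonzero[of n] by (simp add: power2_eq_square)
  finally show ?thesis .
qed

lemma character_commutator:
  "character scaleV (v ` {..<p}) act (commutator \<Delta> S g Lam Lam) = 4 * of_nat p ^ 3 * q_fact q (p - 1) ^ 4"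
proof -
  have "character scaleV (v ` {..<p}) act (commutator \<Delta> S g Lam Lam) = of_nat p * trace_const ^ 2"
    by (simp add: character_eq mat_commutator)
  then show ?thesis
    unfolding trace_const_square by (simp add: power3_eq_cube power2_eq_square)
qed

end

theorem proposition8p1:
  fixes scale :: "'k::field_char_0 \<Rightarrow> 'h::ring_1 \<Rightarrow> 'h"
    and \<Delta> :: "'h \<Rightarrow> ('h \<times> 'h) multiset"
    and \<epsilon> :: "'h \<Rightarrow> 'k"
    and S :: "'h \<Rightarrow> 'h"
    and p :: nat and q :: 'k
    and E F K \<Lambda> g :: 'h
    and lam :: "'h \<Rightarrow> 'k"
    and scaleV :: "'k \<Rightarrow> 'v::ab_group_add \<Rightarrow> 'v"
    and act :: "'h \<Rightarrow> 'v \<Rightarrow> 'v"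
    and v :: "nat \<Rightarrow> 'v"
  assumes p_ge_2: "p \<ge> 2"
    and q_root: "primitive_root_of_unity (2 * p) q"
    and uq: "restricted_quantum_sl2 scale \<Delta> \<epsilon> S p q E F K"
    and Lambda: "\<Lambda> = F ^ (p - 1) * E ^ (p - 1) * (\<Sum>j = 0..2 * p - 1. K ^ j)"
    and integral: "right_integral_dual scale \<Delta> lam"
    and integral_nonzero: "\<exists>a. lam a \<noteq> 0"
    and distinguished: "distinguished_grouplike scale \<Delta> lam g"
    and V_module: "algebra_module scale scaleV act"
    and V_basis_inj: "inj_on v {..<p}"
    and V_basis_indep: "\<not> module.dependent scaleV (v ` {..<p})"
    and V_basis_span: "module.span scaleV (v ` {..<p}) = UNIV"
    and K_act: "\<And>n. n < p \<Longrightarrow> act K (v n) = scaleV (q powi (int p - 1 - 2 * int n)) (v n)"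
    and E_act: "\<And>n. n < p \<Longrightarrow> act E (v n) =
      (if n = 0 then 0 else scaleV (q_int q n * q_int q (p - n)) (v (n - 1)))"
    and F_act: "\<And>n. n < p \<Longrightarrow> act F (v n) = (if n = p - 1 then 0 else v (n + 1))"
  shows "character scaleV (v ` {..<p}) act (commutator \<Delta> S g \<Lambda> \<Lambda>) =
    4 * of_nat p ^ 3 * q_fact q (p - 1) ^ 4"
proof -
  interpret U: restricted_quantum_sl2 scale \<Delta> \<epsilon> S p q E F K by (rule uq)
  interpret M: algebra_module scale scaleV act by (rule V_module)
  have "restricted_quantum_sl2_at_root scale \<Delta> \<epsilon> S p q E F K"
    by unfold_locales (fact p_ge_2 q_root)+
  then interpret A: restricted_quantum_sl2_at_root scale \<Delta> \<epsilon> S p q E F K .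
  interpret steinberg_integral scale \<Delta> \<epsilon> S p q E F K scaleV act v lam g
    by unfold_locales (fact V_basis_inj V_basis_indep V_basis_span K_act E_act F_act
        integral integral_nonzero distinguished)+
  show ?thesis
    using character_commutator by (simp only: Lambda A.Lam_def)
qed

end
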